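(* For every integer $t\ge 3$, if a graph $G$ has a circular drawing whose crossing graph has no $K_t$-minor, then $G$ has treewidth at most $12t-23$.
   Context: A circular drawing of a graph $G$ places the vertices of $G$ at distinct points on a circle and draws each edge as the straight line segment between its endpoints. Two edges cross if their segments intersect at a point that is not an endpoint of either. The crossing graph $X_D$ of a circular drawing $D$ of $G$ is the graph with vertex set $E(G)$ in which two edges are adjacent if and only if they cross in $D$. *)

theory Defs
  imports "HOL-Analysis.Analysis"
begin

record 'a ugraph =
  verts :: "'a set"
  edges :: "'a set set"

definition finite_simple_graph :: "'a ugraph \<Rightarrow> bool" where
  "finite_simple_graph G \<longleftrightarrow>
     finite (verts G) \<and> (\<forall>e \<in> edges G. e \<subseteq> verts G \<and> card e = 2)"

(* The subgraph of G induced by S is nonempty and connected. *)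
definition connected_in :: "'a ugraph \<Rightarrow> 'a set \<Rightarrow> bool" where
  "connected_in G S \<longleftrightarrow>
     S \<noteq> {} \<and> S \<subseteq> verts G \<and>
     (\<forall>u \<in> S. \<forall>v \<in> S. (u, v) \<in> {(x, y). x \<in> S \<and> y \<in> S \<and> {x, y} \<in> edges G}\<^sup>*)"

definition is_cycle :: "'a ugraph \<Rightarrow> 'a list \<Rightarrow> bool" where
  "is_cycle G xs \<longleftrightarrow>
     length xs \<ge> 3 \<and> distinct xs \<and> set xs \<subseteq> verts G \<and>
     (\<forall>i < length xs. {xs ! i, xs ! ((i + 1) mod length xs)} \<in> edges G)"

definition is_tree :: "'a ugraph \<Rightarrow> bool" where
  "is_tree T \<longleftrightarrow>
     finite_simple_graph T \<and> connected_in T (verts T) \<and> (\<nexists>xs. is_cycle T xs)"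

definition tree_decomposition :: "'a ugraph \<Rightarrow> 'b ugraph \<Rightarrow> ('b \<Rightarrow> 'a set) \<Rightarrow> bool" where
  "tree_decomposition G T B \<longleftrightarrow>
     is_tree T \<and>
     (\<forall>x \<in> verts T. B x \<subseteq> verts G) \<and>
     (\<forall>e \<in> edges G. \<exists>x \<in> verts T. e \<subseteq> B x) \<and>
     (\<forall>v \<in> verts G. connected_in T {x \<in> verts T. v \<in> B x})"

(* Integer valued: the empty graph has treewidth -1. *)
definition decomposition_width :: "'b ugraph \<Rightarrow> ('b \<Rightarrow> 'a set) \<Rightarrow> int" where
  "decomposition_width T B = int (Max ((\<lambda>x. card (B x)) ` verts T)) - 1"

(* Every finite tree is isomorphic to one whose nodes are natural numbers, so fixing
   the node type is no restriction.  For finite G the set is nonempty (take one bag)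
   and bounded below by -1, so the infimum is a minimum. *)
definition treewidth :: "'a ugraph \<Rightarrow> int" where
  "treewidth G =
     Inf {decomposition_width T B | (T :: nat ugraph) B. tree_decomposition G T B}"

definition complete_graph :: "nat \<Rightarrow> nat ugraph" where
  "complete_graph t =
     \<lparr>verts = {..<t}, edges = {{i, j} | i j. i < t \<and> j < t \<and> i \<noteq> j}\<rparr>"

(* H is a minor of G: G contains a model of H, with branch sets M x. *)
definition has_minor :: "'a ugraph \<Rightarrow> 'b ugraph \<Rightarrow> bool" where
  "has_minor G H \<longleftrightarrow>
     (\<exists>M :: 'b \<Rightarrow> 'a set.
        (\<forall>x \<in> verts H. connected_in G (M x)) \<and>
        (\<forall>x \<in> verts H. \<forall>y \<in> verts H. x \<noteq> y \<longrightarrow> M x \<inter> M y = {}) \<and>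
        (\<forall>x \<in> verts H. \<forall>y \<in> verts H. {x, y} \<in> edges H \<longrightarrow>
           (\<exists>u \<in> M x. \<exists>v \<in> M y. {u, v} \<in> edges G)))"

definition circular_drawing :: "'a ugraph \<Rightarrow> ('a \<Rightarrow> complex) \<Rightarrow> bool" where
  "circular_drawing G D \<longleftrightarrow>
     inj_on D (verts G) \<and> (\<exists>c r. r > 0 \<and> D ` verts G \<subseteq> sphere c r)"

definition edges_cross :: "('a \<Rightarrow> complex) \<Rightarrow> 'a set \<Rightarrow> 'a set \<Rightarrow> bool" where
  "edges_cross D e f \<longleftrightarrow>
     e \<noteq> f \<and>
     (\<exists>u v x y. e = {u, v} \<and> f = {x, y} \<and>
        (\<exists>z. z \<in> closed_segment (D u) (D v) \<and> z \<in> closed_segment (D x) (D y) \<and>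
             z \<notin> {D u, D v, D x, D y}))"

definition crossing_graph :: "'a ugraph \<Rightarrow> ('a \<Rightarrow> complex) \<Rightarrow> 'a set ugraph" where
  "crossing_graph G D =
     \<lparr>verts = edges G,
      edges = {{e, f} | e f. e \<in> edges G \<and> f \<in> edges G \<and> edges_cross D e f}\<rparr>"

end

theory Submission
  imports Defs
begin

text \<open>
  A symmetric cut function argument reduces the theorem to finding a triangulation of the polygon of
  vertices in which every diagonal $pq$ is crossed by at most $4t - 10$ edges: adding $p$ and $q$,
  every cut has a vertex cover of size $4t - 8$, and three such covers make up a bag.

  For a cell of the arrangement of chords, let the depth of a vertex be the number of edges separating
  it from the cell. Each edge cuts off an arc not containing the cell; a minimal family of
  inclusion-maximal arcs covering all vertices is a cycle in the crossing graph and covers every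
  vertex at most twice. Removing such rings repeatedly, every ring crosses every later one, and the
  first one contributes a $K_3$ minor. Without $K_t$ minor there are at most $t - 3$ rings, so every
  cell has a vertex of depth at most $2(t - 3)$.

  Label every cell by its nearest vertices. A diagonal $pq$ is good if cells labelled $p$ and $q$ meet
  in a point; with no three chords concurrent, it is crossed by at most $2 \cdot 2(t - 3) + 2$ edges.
  A Brouwer (Poincare-Miranda) argument in the region between such a point and the arc from $p$ to
  $q$ yields a vertex $r$ on this arc with $pr$ and $rq$ good, and hence the triangulation.
\<close>

section \<open>Tree decompositions from thin cuts\<close>

text \<open>The drawing enters only through the cyclic order of the vertices: a minor of the graph
  of interleaving pairs is a minor of the crossing graph. So the vertices may be moved to a
  parabola, projectively a circle, and spread there until at most two chords pass through any
  interior point; this is the \<open>2\<close> added to the two depths. Independently chosen covers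
  of the three sides of a triangle would not fit together into a tree decomposition. They are
  therefore minimum covers pushed inwards as far as possible, so that covers of nested or disjoint
  arcs agree where they must. The obstacle in the topological step is the boundary: a common point
  of two labels on the parabola itself gives no bound on crossings, and the corners \<open>p\<close>
  and \<open>q\<close> would be trivial solutions. Labels are trimmed near these corners, and any
  other boundary solution is traded for two interior points. Bags of size
  \<open>3 * (4 * t - 8)\<close> even give treewidth at most \<open>12 * t - 25\<close>.\<close>

definition join_trees :: "'b ugraph \<Rightarrow> 'b \<Rightarrow> 'b ugraph \<Rightarrow> 'b \<Rightarrow> 'b ugraph" where
  "join_trees T x U y =
     \<lparr>verts = verts T \<union> verts U, edges = insert {x, y} (edges T \<union> edges U)\<rparr>"

section \<open>Joining trees and bounding the treewidth\<close>

lemma connected_in_mono_graph: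
  assumes "connected_in T S" "verts T \<subseteq> verts U" "edges T \<subseteq> edges U"
  shows "connected_in U S"
proof -
  have "{(x, y). x \<in> S \<and> y \<in> S \<and> {x, y} \<in> edges T}\<^sup>* \<subseteq> {(x, y). x \<in> S \<and> y \<in> S \<and> {x, y} \<in> edges U}\<^sup>*"
    by (rule rtrancl_mono) (use assms(3) in auto)
  then show ?thesis using assms(1,2) unfolding connected_in_def by blast
qed

lemma connected_in_Un:
  assumes A: "connected_in T A" and B: "connected_in T B"
    and x: "x \<in> A" and y: "y \<in> B" and xy: "x = y \<or> {x, y} \<in> edges T"
  shows "connected_in T (A \<union> B)"
proof -
  let ?R = "\<lambda>S. {(x, y). x \<in> S \<and> y \<in> S \<and> {x, y} \<in> edges T}\<^sup>*"
  have mA: "?R A \<subseteq> ?R (A \<union> B)" by (rule rtrancl_mono) auto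
  have mB: "?R B \<subseteq> ?R (A \<union> B)" by (rule rtrancl_mono) auto
  have A': "(u, v) \<in> ?R (A \<union> B)" if "u \<in> A" "v \<in> A" for u v
    using A that mA unfolding connected_in_def by blast
  have B': "(u, v) \<in> ?R (A \<union> B)" if "u \<in> B" "v \<in> B" for u v
    using B that mB unfolding connected_in_def by blast
  have xy1: "(x, y) \<in> ?R (A \<union> B)" and xy2: "(y, x) \<in> ?R (A \<union> B)"
    using xy x y by (auto intro: r_into_rtrancl simp: insert_commute)
  have AB: "(u, v) \<in> ?R (A \<union> B)" if "u \<in> A" "v \<in> B" for u v
    using A'[OF that(1) x] xy1 B'[OF y that(2)] by (meson rtrancl_trans)
  have BA: "(v, u) \<in> ?R (A \<union> B)" if "u \<in> A" "v \<in> B" for u v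
    using A'[OF x that(1)] xy2 B'[OF that(2) y] by (meson rtrancl_trans)
  show ?thesis
    using A B A' B' AB BA unfolding connected_in_def by blast
qed

lemma connected_in_singleton: "x \<in> verts T \<Longrightarrow> connected_in T {x}"
  unfolding connected_in_def by auto

lemma is_tree_singleton: "is_tree \<lparr>verts = {x}, edges = {}\<rparr>"
proof -
  have "\<not> is_cycle \<lparr>verts = {x}, edges = {}\<rparr> xs" for xs
  proof
    assume c: "is_cycle \<lparr>verts = {x}, edges = {}\<rparr> xs"
    then have "distinct xs" "set xs \<subseteq> {x}" unfolding is_cycle_def by auto
    then have "length xs \<le> card {x}" by (metis card_mono distinct_card finite.emptyI finite_insert)
    then show False using c unfolding is_cycle_def by simp
  qed
  then show ?thesis
    unfolding is_tree_def finite_simple_graph_def by (auto intro!: connected_in_singleton)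
qed

lemma cyclic_exit:
  fixes P :: "nat \<Rightarrow> bool"
  assumes "i < n" "j < n" "P i" "\<not> P j"
  shows "\<exists>k<n. P k \<and> \<not> P ((k + 1) mod n)"
proof (rule ccontr)
  assume "\<not> ?thesis"
  then have step: "P ((k + 1) mod n)" if "k < n" "P k" for k using that by blast
  have "P ((i + m) mod n)" for m
  proof (induction m)
    case 0 then show ?case using assms by simp
  next
    case (Suc m)
    from step[OF _ Suc] assms(1) show ?case by (simp add: mod_Suc_eq)
  qed
  from this[of "n - i + j"] assms show False by simp
qed

text \<open>A cycle meeting both sides must use the bridge from \<open>x\<close> to \<open>y\<close>
  and also from \<open>y\<close> to \<open>x\<close>. As it visits \<open>x\<close> and
  \<open>y\<close> once each, they would follow each other in both directions, which a cycle of
  length at least 3 forbids.\<close>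

lemma is_tree_join:
  assumes T: "is_tree T" and U: "is_tree U" and disj: "verts T \<inter> verts U = {}"
    and x: "x \<in> verts T" and y: "y \<in> verts U"
  shows "is_tree (join_trees T x U y)" (is "is_tree ?J")
proof -
  have xy: "x \<noteq> y" using x y disj by auto
  have fT: "finite_simple_graph T" and fU: "finite_simple_graph U"
    using T U unfolding is_tree_def by auto
  have eT: "e \<subseteq> verts T" "card e = 2" if "e \<in> edges T" for e
    using fT that unfolding finite_simple_graph_def by auto
  have eU: "e \<subseteq> verts U" "card e = 2" if "e \<in> edges U" for e
    using fU that unfolding finite_simple_graph_def by auto
  have vJ: "verts ?J = verts T \<union> verts U" and eJ: "edges ?J = insert {x, y} (edges T \<union> edges U)"
    unfolding join_trees_def by auto
  have f: "finite_simple_graph ?J"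
    using fT fU xy x y unfolding finite_simple_graph_def vJ eJ by auto
  have c: "connected_in ?J (verts ?J)"
    unfolding vJ
  proof (rule connected_in_Un[OF _ _ x y])
    show "connected_in ?J (verts T)" "connected_in ?J (verts U)"
      using T U unfolding is_tree_def by (auto intro: connected_in_mono_graph simp: vJ eJ)
  qed (simp add: eJ)
  have "\<not> is_cycle ?J xs" for xs
  proof
    assume cyc: "is_cycle ?J xs"
    define n where "n = length xs"
    have n: "n \<ge> 3" and d: "distinct xs" and s: "set xs \<subseteq> verts T \<union> verts U"
      using cyc unfolding is_cycle_def vJ eJ n_def by auto
    have e: "{xs ! i, xs ! ((i + 1) mod n)} \<in> insert {x, y} (edges T \<union> edges U)" if "i < n" for i
      using cyc that unfolding is_cycle_def vJ eJ n_def by auto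
    have mod: "(i + 1) mod n < n" for i using n by simp
    have mem: "xs ! i \<in> verts T \<union> verts U" if "i < n" for i using s that n_def nth_mem by blast
    have in_edge: "{u, v} \<in> edges T" if "u \<in> verts T" "v \<in> verts T"
      "{u, v} \<in> insert {x, y} (edges T \<union> edges U)" for u v
      using that eU[of "{u, v}"] y disj by (auto simp: doubleton_eq_iff)
    have in_edge': "{u, v} \<in> edges U" if "u \<in> verts U" "v \<in> verts U"
      "{u, v} \<in> insert {x, y} (edges T \<union> edges U)" for u v
      using that eT[of "{u, v}"] x disj by (auto simp: doubleton_eq_iff)
    have cross: "u = x \<and> v = y" if "u \<in> verts T" "v \<in> verts U"
      "{u, v} \<in> insert {x, y} (edges T \<union> edges U)" for u v
      using that eT[of "{u, v}"] eU[of "{u, v}"] x y disj by (auto simp: doubleton_eq_iff)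
    show False
    proof (cases "(\<exists>i<n. xs ! i \<in> verts T) \<and> (\<exists>j<n. xs ! j \<notin> verts T)")
      case True
      then obtain i j where ij: "i < n" "xs ! i \<in> verts T" "j < n" "xs ! j \<notin> verts T" by auto
      obtain k where k: "k < n" "xs ! k \<in> verts T" "xs ! ((k + 1) mod n) \<notin> verts T"
        using cyclic_exit[of i n j "\<lambda>i. xs ! i \<in> verts T"] ij by auto
      obtain l where l: "l < n" "xs ! l \<notin> verts T" "xs ! ((l + 1) mod n) \<in> verts T"
        using cyclic_exit[of j n i "\<lambda>i. xs ! i \<notin> verts T"] ij by auto
      have 1: "xs ! k = x" "xs ! ((k + 1) mod n) = y"
        using cross[OF k(2) _ e[OF k(1)]] mem[OF mod[of k]] k by auto
      have 2: "xs ! ((l + 1) mod n) = x" "xs ! l = y"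
        using cross[OF l(3), of "xs ! l"] e[OF l(1)] mem[OF l(1)] l by (auto simp: insert_commute)
      have "k = (l + 1) mod n" "l = (k + 1) mod n"
        using d 1 2 k(1) l(1) mod nth_eq_iff_index_eq[OF d] unfolding n_def by metis+
      then have "k = (k + 2) mod n" by (metis add.assoc mod_add_left_eq one_add_one)
      then show False using k(1) n
        by (cases "k + 2 < n") (auto simp: le_mod_geq)
    next
      case False
      then consider "\<forall>i<n. xs ! i \<in> verts T" | "\<forall>i<n. xs ! i \<in> verts U"
        using mem by blast
      then show False
      proof cases
        case 1
        then have "is_cycle T xs"
          unfolding is_cycle_def n_def[symmetric] using n d in_edge[OF _ _ e] mod
          by (auto simp: in_set_conv_nth n_def[symmetric])
        then show False using T unfolding is_tree_def by auto
      next
        case 2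
        then have "is_cycle U xs"
          unfolding is_cycle_def n_def[symmetric] using n d in_edge'[OF _ _ e] mod
          by (auto simp: in_set_conv_nth n_def[symmetric])
        then show False using U unfolding is_tree_def by auto
      qed
    qed
  qed
  then show ?thesis using f c unfolding is_tree_def by auto
qed

lemma treewidth_le:
  fixes T :: "nat ugraph"
  assumes td: "tree_decomposition G T B" and w: "\<And>x. x \<in> verts T \<Longrightarrow> card (B x) \<le> w"
  shows "treewidth G \<le> int w - 1"
proof -
  have T: "finite (verts T)" "verts T \<noteq> {}"
    using td unfolding tree_decomposition_def is_tree_def finite_simple_graph_def connected_in_def by auto
  have "decomposition_width T B \<le> int w - 1"
  proof -
    have "Max ((\<lambda>x. card (B x)) ` verts T) \<le> w" using T w by simp
    then show ?thesis unfolding decomposition_width_def by linarith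
  qed
  moreover have "treewidth G \<le> decomposition_width T B"
    unfolding treewidth_def
  proof (rule cInf_lower)
    show "bdd_below {decomposition_width T B | (T :: nat ugraph) B. tree_decomposition G T B}"
      by (rule bdd_belowI[of _ "-1"]) (auto simp: decomposition_width_def)
  qed (use td in blast)
  ultimately show ?thesis by linarith
qed

section \<open>Minimum vertex covers of a cut\<close>

definition cut_cover :: "'a ugraph \<Rightarrow> 'a set \<Rightarrow> 'a set \<Rightarrow> bool" where
  "cut_cover G I S \<longleftrightarrow> S \<subseteq> verts G \<and>
     (\<forall>u v. {u, v} \<in> edges G \<longrightarrow> u \<in> I \<longrightarrow> v \<notin> I \<longrightarrow> u \<in> S \<or> v \<in> S)"

definition min_cut_cover :: "'a ugraph \<Rightarrow> 'a set \<Rightarrow> 'a set \<Rightarrow> bool" where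
  "min_cut_cover G I S \<longleftrightarrow> cut_cover G I S \<and> (\<forall>S'. cut_cover G I S' \<longrightarrow> card S \<le> card S')"

text \<open>Preferring vertices inside \<open>I\<close> among the minimum covers turns
  submodularity, an inequality between sizes, into an inclusion between the covers
  themselves.\<close>

definition inner_cut_cover :: "'a ugraph \<Rightarrow> 'a set \<Rightarrow> 'a set \<Rightarrow> bool" where
  "inner_cut_cover G I S \<longleftrightarrow> min_cut_cover G I S \<and>
     (\<forall>S'. min_cut_cover G I S' \<longrightarrow> card (S' \<inter> I) \<le> card (S \<inter> I))"

lemma ex_inner_cut_cover:
  assumes "finite (verts G)" "cut_cover G I S0"
  obtains S where "inner_cut_cover G I S" "card S \<le> card S0"
proof -
  obtain M where M: "cut_cover G I M" "\<And>S'. cut_cover G I S' \<Longrightarrow> card M \<le> card S'"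
    using ex_has_least_nat[of "cut_cover G I" S0 card] assms(2) by blast
  then have m: "min_cut_cover G I M" unfolding min_cut_cover_def by auto
  have bound: "\<forall>S'. min_cut_cover G I S' \<longrightarrow> card (S' \<inter> I) < Suc (card (verts G))"
    using assms(1) unfolding min_cut_cover_def cut_cover_def
    by (meson card_mono inf_le1 le_imp_less_Suc order_trans)
  obtain S where S: "min_cut_cover G I S" "\<And>S'. min_cut_cover G I S' \<Longrightarrow> card (S' \<inter> I) \<le> card (S \<inter> I)"
    using ex_has_greatest_nat[of "min_cut_cover G I" M "\<lambda>S. card (S \<inter> I)" "Suc (card (verts G))"]
      m bound by (auto simp: less_imp_le)
  show thesis
  proof
    show "inner_cut_cover G I S" using S unfolding inner_cut_cover_def by auto
    show "card S \<le> card S0" using S(1) assms(2) unfolding min_cut_cover_def by auto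
  qed
qed

lemma min_cut_cover_compl:
  assumes g: "finite_simple_graph G" and "min_cut_cover G I S"
  shows "min_cut_cover G (verts G - I) S"
proof -
  have e: "{v, u} \<in> edges G" "u \<in> verts G" "v \<in> verts G" if "{u, v} \<in> edges G" for u v
    using g that unfolding finite_simple_graph_def by (auto simp: insert_commute)
  have "cut_cover G (verts G - I) S' = cut_cover G I S'" for S'
    unfolding cut_cover_def
    by (rule conj_cong[OF refl], rule iffI; intro allI impI; use e in blast)
  then show ?thesis using assms(2) unfolding min_cut_cover_def by auto
qed

text \<open>Submodularity of the minimum cover size: the two covers are exchanged for two covers
  of the same total size, the first of which has more vertices inside \<^term>\<open>I\<close>.\<close>

lemma inner_cut_cover_uncross:
  assumes fin: "finite (verts G)" and IJ: "I \<subseteq> J"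
    and S: "inner_cut_cover G I S" and T: "min_cut_cover G J T"
  shows "T \<inter> I \<subseteq> S"
proof -
  have cS: "cut_cover G I S" and cT: "cut_cover G J T"
    using S T unfolding inner_cut_cover_def min_cut_cover_def by auto
  then have sub: "S \<subseteq> verts G" "T \<subseteq> verts G" unfolding cut_cover_def by auto
  then have fS: "finite S" and fT: "finite T" using fin finite_subset by auto
  \<comment> \<open>An edge from \<open>I\<close> to the outside of \<open>J\<close> is covered by
    both \<open>S\<close> and \<open>T\<close>, so it stays covered when one new set takes the union
    inside \<open>I\<close> and the intersection outside \<open>J\<close>, and the other does the
    opposite. The remaining edges have an end in \<open>J - I\<close>, where \<open>C\<close>
    follows \<open>S\<close> and \<open>D\<close> follows \<open>T\<close>.\<close>
  define C where "C = ((S \<union> T) \<inter> I) \<union> (S \<inter> (J - I)) \<union> (S \<inter> T - J)"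
  define D where "D = ((S \<inter> T) \<inter> I) \<union> (T \<inter> (J - I)) \<union> ((S \<union> T) - J)"
  have cC: "cut_cover G I C"
    unfolding cut_cover_def
  proof (intro conjI allI impI)
    fix u v assume e: "{u, v} \<in> edges G" "u \<in> I" "v \<notin> I"
    then show "u \<in> C \<or> v \<in> C"
      using cS cT IJ unfolding cut_cover_def C_def by blast
  qed (use sub C_def in auto)
  have cD: "cut_cover G J D"
    unfolding cut_cover_def
  proof (intro conjI allI impI)
    fix u v assume e: "{u, v} \<in> edges G" "u \<in> J" "v \<notin> J"
    then show "u \<in> D \<or> v \<in> D"
      using cS cT IJ unfolding cut_cover_def D_def by blast
  qed (use sub D_def in auto)
  have fC: "finite C" and fD: "finite D" using fS fT unfolding C_def D_def by auto
  have "C \<union> D = S \<union> T" "C \<inter> D = S \<inter> T" using IJ unfolding C_def D_def by auto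
  then have "card C + card D = card S + card T"
    using card_Un_Int[OF fC fD] card_Un_Int[OF fS fT] by simp
  moreover have "card T \<le> card D" using T cD unfolding min_cut_cover_def by auto
  moreover have Smin: "\<And>S'. cut_cover G I S' \<Longrightarrow> card S \<le> card S'"
    using S unfolding inner_cut_cover_def min_cut_cover_def by auto
  ultimately have "min_cut_cover G I C"
    unfolding min_cut_cover_def using cC by (metis add_le_cancel_right add_le_mono order_trans
        add_le_imp_le_right le_trans add.commute)
  then have le: "card (C \<inter> I) \<le> card (S \<inter> I)" using S unfolding inner_cut_cover_def by auto
  have "S \<inter> I \<subseteq> C \<inter> I" unfolding C_def by auto
  then have "S \<inter> I = C \<inter> I" using le fC by (simp add: card_seteq)
  then show ?thesis unfolding C_def by auto
qed

text \<open>Vertices of \<open>S\<close> outside \<open>J \<union> T\<close> could be dropped: an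
  edge from \<open>I\<close> to the outside of \<open>J\<close> has its outer end in
  \<open>T\<close>, or its inner end in \<open>T \<inter> I\<close>, which lies in \<open>S\<close>
  by uncrossing. This keeps the new root bag inside the allowed vertex set.\<close>

lemma inner_cut_cover_outside:
  assumes fin: "finite (verts G)" and IJ: "I \<subseteq> J"
    and S: "inner_cut_cover G I S" and T: "min_cut_cover G J T"
  shows "S \<subseteq> J \<union> T"
proof -
  have cS: "cut_cover G I S" and cT: "cut_cover G J T"
    using S T unfolding inner_cut_cover_def min_cut_cover_def by auto
  then have "finite S" using fin finite_subset unfolding cut_cover_def by auto
  have un: "T \<inter> I \<subseteq> S" by (rule inner_cut_cover_uncross[OF fin IJ S T])
  have "cut_cover G I (S \<inter> (J \<union> T))"
    unfolding cut_cover_def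
  proof (intro conjI allI impI)
    fix u v assume e: "{u, v} \<in> edges G" "u \<in> I" "v \<notin> I"
    then show "u \<in> S \<inter> (J \<union> T) \<or> v \<in> S \<inter> (J \<union> T)"
      using cS cT IJ un unfolding cut_cover_def by blast
  qed (use cS in \<open>auto simp: cut_cover_def\<close>)
  then have "card S \<le> card (S \<inter> (J \<union> T))"
    using S unfolding inner_cut_cover_def min_cut_cover_def by auto
  then have "S \<inter> (J \<union> T) = S" using \<open>finite S\<close> by (intro card_seteq) auto
  then show ?thesis by blast
qed

text \<open>A rooted binary hierarchy of vertex sets, with single vertices as leaves, all of whose
  cuts are cheap to cover. The cut of a leaf is covered by the leaf itself, so only unions carry a
  bound.\<close>

inductive thin_laminar :: "'a ugraph \<Rightarrow> nat \<Rightarrow> 'a set \<Rightarrow> bool" for G k where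
  single: "v \<in> verts G \<Longrightarrow> thin_laminar G k {v}"
| union: "thin_laminar G k I \<Longrightarrow> thin_laminar G k J \<Longrightarrow> I \<inter> J = {} \<Longrightarrow>
    cut_cover G (I \<union> J) S \<Longrightarrow> card S \<le> k \<Longrightarrow> thin_laminar G k (I \<union> J)"

lemma thin_laminar_subset: "thin_laminar G k I \<Longrightarrow> I \<subseteq> verts G"
  by (induction rule: thin_laminar.induct) auto

lemma cut_cover_single: "v \<in> verts G \<Longrightarrow> cut_cover G {v} {v}"
  unfolding cut_cover_def by auto

lemma thin_laminar_cover:
  assumes "thin_laminar G k I" "k \<ge> 1"
  shows "\<exists>S. cut_cover G I S \<and> card S \<le> k"
  using assms(1)
proof cases
  case (single v)
  then show ?thesis using cut_cover_single[of v G] assms(2) by (intro exI[of _ "{v}"]) auto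
qed auto

text \<open>The root bag of the decomposition of \<^term>\<open>G\<close> restricted to \<^term>\<open>I \<union> S\<close> contains \<^term>\<open>S\<close>;
  nodes are taken above \<^term>\<open>m\<close> so that decompositions can be made disjoint.\<close>

lemma thin_laminar_decomposition:
  fixes m :: nat
  assumes G: "finite_simple_graph G" and k: "k \<ge> 1"
    and "thin_laminar G k I" and "inner_cut_cover G I S"
  shows "\<exists>T B \<rho>. is_tree T \<and> verts T \<subseteq> {m..} \<and> \<rho> \<in> verts T \<and> S \<subseteq> B \<rho> \<and>
    (\<forall>x\<in>verts T. B x \<subseteq> I \<union> S \<and> card (B x) \<le> 3 * k) \<and>
    (\<forall>e\<in>edges G. e \<subseteq> I \<union> S \<longrightarrow> (\<exists>x\<in>verts T. e \<subseteq> B x)) \<and>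
    (\<forall>v\<in>I \<union> S. connected_in T {x \<in> verts T. v \<in> B x})"
  using assms(3,4)
proof (induction arbitrary: m S rule: thin_laminar.induct)
  case (single v)
  have fin: "finite (verts G)" using G unfolding finite_simple_graph_def by auto
  have "card S \<le> 1"
    using single cut_cover_single[of v G] unfolding inner_cut_cover_def min_cut_cover_def by fastforce
  then have "card ({v} \<union> S) \<le> 3 * k" using k card_Un_le[of "{v}" S] by simp
  then show ?case
    by (intro exI[of _ "\<lparr>verts = {m}, edges = {}\<rparr>"] exI[of _ "\<lambda>_. {v} \<union> S"] exI[of _ m])
      (auto simp: is_tree_singleton intro!: connected_in_singleton)
next
  case (union I1 I2 S0)
  have fin: "finite (verts G)" using G unfolding finite_simple_graph_def by auto
  obtain R1 R2 where R: "cut_cover G I1 R1" "card R1 \<le> k" "cut_cover G I2 R2" "card R2 \<le> k"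
    using thin_laminar_cover[OF union.hyps(1) k] thin_laminar_cover[OF union.hyps(2) k] by blast
  obtain S1 where S1: "inner_cut_cover G I1 S1" "card S1 \<le> k"
  proof (rule ex_inner_cut_cover[OF fin R(1)])
  qed (use R(2) that in auto)
  obtain S2 where S2: "inner_cut_cover G I2 S2" "card S2 \<le> k"
  proof (rule ex_inner_cut_cover[OF fin R(3)])
  qed (use R(4) that in auto)
  have cardS: "card S \<le> k"
    using union.prems union.hyps(4,5) unfolding inner_cut_cover_def min_cut_cover_def
    using order_trans by blast
  have minS: "min_cut_cover G (I1 \<union> I2) S" and min1: "min_cut_cover G I1 S1" and min2: "min_cut_cover G I2 S2"
    using union.prems S1 S2 unfolding inner_cut_cover_def by auto
  have cS: "cut_cover G (I1 \<union> I2) S" and c1: "cut_cover G I1 S1" and c2: "cut_cover G I2 S2"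
    using minS min1 min2 unfolding min_cut_cover_def by auto
  have I12: "I1 \<subseteq> verts G - I2" "I2 \<subseteq> verts G - I1"
    using union.hyps(3) thin_laminar_subset[OF union.hyps(1)] thin_laminar_subset[OF union.hyps(2)] by auto
  \<comment> \<open>By \<open>u1\<close> to \<open>u4\<close>, a vertex of the new root bag
    \<open>S \<union> S1 \<union> S2\<close> that occurs below in the tree of \<open>I1\<close> lies
    in \<open>S1\<close>, hence in the root bag of that tree, and likewise for \<open>I2\<close>.
    This keeps its nodes connected. For \<open>u3\<close> and \<open>u4\<close> the disjoint sets
    are made nested by complementing one of them.\<close>
  have u1: "S \<inter> I1 \<subseteq> S1" by (rule inner_cut_cover_uncross[OF fin _ S1(1) minS]) auto
  have u2: "S \<inter> I2 \<subseteq> S2" by (rule inner_cut_cover_uncross[OF fin _ S2(1) minS]) auto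
  have u3: "S2 \<inter> I1 \<subseteq> S1"
    by (rule inner_cut_cover_uncross[OF fin I12(1) S1(1) min_cut_cover_compl[OF G min2]])
  have u4: "S1 \<inter> I2 \<subseteq> S2"
    by (rule inner_cut_cover_uncross[OF fin I12(2) S2(1) min_cut_cover_compl[OF G min1]])
  have o1: "S1 \<subseteq> (I1 \<union> I2) \<union> S" by (rule inner_cut_cover_outside[OF fin _ S1(1) minS]) auto
  have o2: "S2 \<subseteq> (I1 \<union> I2) \<union> S" by (rule inner_cut_cover_outside[OF fin _ S2(1) minS]) auto
  obtain T1 B1 r1 where T1: "is_tree T1" "verts T1 \<subseteq> {Suc m..}" "r1 \<in> verts T1" "S1 \<subseteq> B1 r1"
    "\<forall>x\<in>verts T1. B1 x \<subseteq> I1 \<union> S1 \<and> card (B1 x) \<le> 3 * k"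
    "\<forall>e\<in>edges G. e \<subseteq> I1 \<union> S1 \<longrightarrow> (\<exists>x\<in>verts T1. e \<subseteq> B1 x)"
    "\<forall>v\<in>I1 \<union> S1. connected_in T1 {x \<in> verts T1. v \<in> B1 x}"
    using union.IH(1)[OF S1(1), of "Suc m"] by (elim exE conjE) (rule that)
  have finT1: "finite (verts T1)" using T1(1) unfolding is_tree_def finite_simple_graph_def by auto
  define n where "n = Suc (Max (verts T1))"
  have n: "x < n" if "x \<in> verts T1" for x unfolding n_def using finT1 that by (simp add: less_Suc_eq_le)
  have mn: "m < n" using n[OF T1(3)] T1(2,3) by auto
  obtain T2 B2 r2 where T2: "is_tree T2" "verts T2 \<subseteq> {n..}" "r2 \<in> verts T2" "S2 \<subseteq> B2 r2"
    "\<forall>x\<in>verts T2. B2 x \<subseteq> I2 \<union> S2 \<and> card (B2 x) \<le> 3 * k"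
    "\<forall>e\<in>edges G. e \<subseteq> I2 \<union> S2 \<longrightarrow> (\<exists>x\<in>verts T2. e \<subseteq> B2 x)"
    "\<forall>v\<in>I2 \<union> S2. connected_in T2 {x \<in> verts T2. v \<in> B2 x}"
    using union.IH(2)[OF S2(1), of n] by (elim exE conjE) (rule that)
  define T0 :: "nat ugraph" where "T0 = \<lparr>verts = {m}, edges = {}\<rparr>"
  define T where "T = join_trees (join_trees T0 m T1 r1) m T2 r2"
  define B where "B x = (if x = m then S \<union> S1 \<union> S2 else if x < n then B1 x else B2 x)" for x
  have mT1: "m \<notin> verts T1" using T1(2) by auto
  have mT2: "m \<notin> verts T2" using T2(2) mn by auto
  have T12: "verts T1 \<inter> verts T2 = {}" using T2(2) n by fastforce
  have vT: "verts T = insert m (verts T1 \<union> verts T2)"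
    and eT: "edges T = insert {m, r2} (insert {m, r1} (edges T1) \<union> edges T2)"
    unfolding T_def join_trees_def T0_def by auto
  have tree: "is_tree T"
    unfolding T_def
    by (intro is_tree_join T1 T2) (use mT1 mT2 T12 T1(3) T2(3) in \<open>auto simp: T0_def join_trees_def is_tree_singleton\<close>)
  have Bm: "B m = S \<union> S1 \<union> S2" unfolding B_def by auto
  have B1: "B x = B1 x" if "x \<in> verts T1" for x using that mT1 n B_def by auto
  have B2: "B x = B2 x" if "x \<in> verts T2" for x
  proof -
    have "x \<ge> n" using that T2(2) by auto
    then show ?thesis using mn B_def by auto
  qed
  have "card (B m) \<le> card S + card S1 + card S2"
    unfolding Bm by (meson add_mono card_Un_le le_refl order_trans)
  then have bags: "\<forall>x\<in>verts T. B x \<subseteq> I1 \<union> I2 \<union> S \<and> card (B x) \<le> 3 * k"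
    using T1(5) T2(5) cardS S1(2) S2(2) o1 o2 B1 B2 Bm unfolding vT by fastforce
  have vm: "m \<in> verts T" "verts T1 \<subseteq> verts T" "verts T2 \<subseteq> verts T" unfolding vT by auto
  have cover: "\<exists>x\<in>verts T. e \<subseteq> B x" if e: "e \<in> edges G" "e \<subseteq> I1 \<union> I2 \<union> S" for e
  proof -
    have "card e = 2" using G e unfolding finite_simple_graph_def by auto
    then obtain u v where uv: "e = {u, v}" by (auto simp: card_2_iff)
    \<comment> \<open>An edge leaving \<open>I1\<close> meets \<open>S1\<close>. If its outer end is
      in \<open>S1\<close>, the first tree has it; otherwise its inner end is, and the outer end is
      in \<open>S\<close>, or in \<open>I2\<close>, where the same argument applies to
      \<open>S2\<close>.\<close>
    have "e \<subseteq> I1 \<union> S1 \<or> e \<subseteq> I2 \<union> S2 \<or> e \<subseteq> S \<union> S1 \<union> S2"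
    proof -
      have a1: "x \<in> S1 \<or> y \<in> S1" if "{x, y} = e" "x \<in> I1" "y \<notin> I1" for x y
        using c1 e that unfolding cut_cover_def by blast
      have a2: "x \<in> S2 \<or> y \<in> S2" if "{x, y} = e" "x \<in> I2" "y \<notin> I2" for x y
        using c2 e that unfolding cut_cover_def by blast
      have "{u, v} = e" "{v, u} = e" using uv by auto
      note a = a1[OF this(1)] a1[OF this(2)] a2[OF this(1)] a2[OF this(2)]
      have "u \<in> I1 \<union> I2 \<union> S" "v \<in> I1 \<union> I2 \<union> S" using e uv by auto
      then show ?thesis unfolding uv using a union.hyps(3) u1 u2 by blast
    qed
    then show ?thesis
      using T1(6) T2(6) e(1) B1 B2 Bm vm by (metis (no_types, lifting) subsetD)
  qed
  have conn: "connected_in T {x \<in> verts T. v \<in> B x}" if v: "v \<in> I1 \<union> I2 \<union> S" for v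
  proof -
    let ?N1 = "{x \<in> verts T1. v \<in> B1 x}" and ?N2 = "{x \<in> verts T2. v \<in> B2 x}"
    let ?N0 = "if v \<in> S \<union> S1 \<union> S2 then {m} else {}"
    have N: "{x \<in> verts T. v \<in> B x} = ?N0 \<union> ?N1 \<union> ?N2"
      using B1 B2 Bm unfolding vT by auto
    have N1: "?N1 = {}" if "v \<notin> I1 \<union> S1" using T1(5) that by auto
    have N2: "?N2 = {}" if "v \<notin> I2 \<union> S2" using T2(5) that by auto
    have C1: "connected_in T ?N1" if "v \<in> I1 \<union> S1"
      using T1(7) that by (auto intro: connected_in_mono_graph simp: vT eT)
    have C2: "connected_in T ?N2" if "v \<in> I2 \<union> S2"
      using T2(7) that by (auto intro: connected_in_mono_graph simp: vT eT)
    have m: "connected_in T {m}" by (rule connected_in_singleton[OF vm(1)])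
    show ?thesis
    proof (cases "v \<in> S \<union> S1 \<union> S2")
      case True
      have s1: "v \<in> S1" if "v \<in> I1 \<union> S1" using that True u1 u3 by auto
      have s2: "v \<in> S2" if "v \<in> I2 \<union> S2" using that True u2 u4 by auto
      have M1: "connected_in T ({m} \<union> ?N1)"
      proof (cases "v \<in> I1 \<union> S1")
        case t: True
        then have "r1 \<in> ?N1" using s1 T1(3,4) by auto
        then show ?thesis
          using connected_in_Un[OF m C1[OF t], of m r1] by (auto simp: eT)
      next
        case f: False
        show ?thesis unfolding N1[OF f] using m by simp
      qed
      have "connected_in T (({m} \<union> ?N1) \<union> ?N2)"
      proof (cases "v \<in> I2 \<union> S2")
        case t: True
        then have "r2 \<in> ?N2" using s2 T2(3,4) by auto
        then show ?thesis
          using connected_in_Un[OF M1 C2[OF t], of m r2] by (auto simp: eT)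
      next
        case f: False
        show ?thesis unfolding N2[OF f] using M1 by simp
      qed
      then show ?thesis unfolding N using True by simp
    next
      case False
      then consider "v \<in> I1" "v \<notin> I2 \<union> S2" | "v \<in> I2" "v \<notin> I1 \<union> S1"
        using v union.hyps(3) by auto
      then show ?thesis
      proof cases
        case 1
        show ?thesis unfolding N N2[OF 1(2)] using False C1 1 by simp
      next
        case 2
        show ?thesis unfolding N N1[OF 2(2)] using False C2 2 by simp
      qed
    qed
  qed
  show ?case
    by (intro exI[of _ T] exI[of _ B] exI[of _ m])
      (use tree bags cover conn Bm vm T1(2) T2(2) mn in \<open>auto simp: vT\<close>)
qed

lemma treewidth_thin_laminar:
  assumes G: "finite_simple_graph G" and k: "k \<ge> 1" and "thin_laminar G k (verts G)"
  shows "treewidth G \<le> 3 * int k - 1"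
proof -
  have "cut_cover G (verts G) {}"
    using G unfolding cut_cover_def finite_simple_graph_def by auto
  then obtain S where S: "inner_cut_cover G (verts G) S" "card S \<le> 0"
    using ex_inner_cut_cover[of G "verts G" "{}"] G unfolding finite_simple_graph_def by auto
  then have "S \<subseteq> verts G" "finite (verts G)"
    using G unfolding inner_cut_cover_def min_cut_cover_def cut_cover_def finite_simple_graph_def by auto
  then have "S = {}" using S(2) finite_subset by fastforce
  with thin_laminar_decomposition[OF assms S(1), of 0] obtain T :: "nat ugraph" and B
    where "is_tree T" "\<forall>x\<in>verts T. B x \<subseteq> verts G \<and> card (B x) \<le> 3 * k"
    "\<forall>e\<in>edges G. e \<subseteq> verts G \<longrightarrow> (\<exists>x\<in>verts T. e \<subseteq> B x)"
    "\<forall>v\<in>verts G. connected_in T {x \<in> verts T. v \<in> B x}" by auto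
  then have "tree_decomposition G T B" "\<And>x. x \<in> verts T \<Longrightarrow> card (B x) \<le> 3 * k"
    using G unfolding tree_decomposition_def finite_simple_graph_def by auto
  from treewidth_le[OF this] show ?thesis by simp
qed

section \<open>Nested rings of chords\<close>

lemma connected_in_component:
  fixes X :: "'b ugraph"
  assumes "g \<in> S" "S \<subseteq> verts X"
  shows "connected_in X {y. (g, y) \<in> {(x, y). x \<in> S \<and> y \<in> S \<and> {x, y} \<in> edges X}\<^sup>*}"
    (is "connected_in X ?K")
proof -
  let ?R = "{(x, y). x \<in> S \<and> y \<in> S \<and> {x, y} \<in> edges X}"
  let ?Q = "{(x, y). x \<in> ?K \<and> y \<in> ?K \<and> {x, y} \<in> edges X}"
  have to: "(g, y) \<in> ?Q\<^sup>*" if "(g, y) \<in> ?R\<^sup>*" for y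
    using that
  proof (induction rule: rtrancl_induct)
    case (step y z)
    then have "(y, z) \<in> ?Q" by (auto intro: rtrancl.rtrancl_into_rtrancl)
    then show ?case using step.IH by (rule rtrancl.rtrancl_into_rtrancl[rotated])
  qed auto
  have "sym ?Q" by (auto simp: sym_def insert_commute)
  then have "sym (?Q\<^sup>*)" by (rule sym_rtrancl)
  then have "(u, v) \<in> ?Q\<^sup>*" if "u \<in> ?K" "v \<in> ?K" for u v
    using to[of u] to[of v] that by (auto dest: symD intro: rtrancl_trans)
  moreover have "?K \<subseteq> S"
  proof
    fix y assume "y \<in> ?K"
    then have "(g, y) \<in> ?R\<^sup>*" by simp
    then show "y \<in> S" by (induction rule: rtrancl_induct) (use assms in auto)
  qed
  moreover have "g \<in> ?K" by simp
  ultimately show ?thesis using assms(2) unfolding connected_in_def by blast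
qed

text \<open>Take a connected \<open>C\<close> as large as possible that has a neighbour
  \<open>e\<close> outside. By maximality all neighbours of \<open>e\<close> lie in
  \<open>C\<close>; let \<open>f\<close> and \<open>g\<close> be two of them. The component
  \<open>D\<close> of \<open>g\<close> in \<open>C - {f}\<close> touches \<open>f\<close>, since a
  walk in \<open>C\<close> can leave \<open>D\<close> only through \<open>f\<close>. Then
  \<open>{e}\<close>, \<open>{f}\<close> and \<open>D\<close> are the branch sets.\<close>

lemma min_degree_two_imp_triangle_minor:
  assumes fin: "finite F" and ne: "F \<noteq> {}" and sub: "F \<subseteq> verts X"
    and deg: "\<forall>e\<in>F. \<exists>f\<in>F. \<exists>g\<in>F.
      f \<noteq> g \<and> f \<noteq> e \<and> g \<noteq> e \<and> {e, f} \<in> edges X \<and> {e, g} \<in> edges X"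
  shows "\<exists>A B C. A \<subseteq> F \<and> B \<subseteq> F \<and> C \<subseteq> F \<and>
    connected_in X A \<and> connected_in X B \<and> connected_in X C \<and>
    A \<inter> B = {} \<and> A \<inter> C = {} \<and> B \<inter> C = {} \<and>
    (\<exists>u\<in>A. \<exists>v\<in>B. {u, v} \<in> edges X) \<and> (\<exists>u\<in>A. \<exists>v\<in>C. {u, v} \<in> edges X) \<and>
    (\<exists>u\<in>B. \<exists>v\<in>C. {u, v} \<in> edges X)"
proof -
  define Q where "Q = (\<lambda>(C, e). C \<subseteq> F \<and> connected_in X C \<and> e \<in> F - C \<and> (\<exists>c\<in>C. {c, e} \<in> edges X))"
  obtain e0 where e0: "e0 \<in> F" using ne by auto
  obtain f0 where f0: "f0 \<in> F" "f0 \<noteq> e0" "{e0, f0} \<in> edges X" using deg e0 by blast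
  have Q0: "Q ({e0}, f0)"
    unfolding Q_def using e0 f0 sub by (auto intro!: connected_in_singleton)
  have "\<forall>y. Q y \<longrightarrow> card (fst y) < Suc (card F)"
    unfolding Q_def using fin by (auto simp: less_Suc_eq_le intro!: card_mono)
  then obtain z where z: "Q z" and max: "\<And>y. Q y \<Longrightarrow> card (fst y) \<le> card (fst z)"
    using ex_has_greatest_nat[of Q _ "\<lambda>y. card (fst y)", OF Q0] by (metis less_imp_le)
  obtain C e where ze: "z = (C, e)" by (cases z)
  obtain c where C: "C \<subseteq> F" "connected_in X C" "e \<in> F" "e \<notin> C" "c \<in> C" "{c, e} \<in> edges X"
    using z unfolding ze Q_def by auto
  have finC: "finite C" using C(1) fin finite_subset by auto
  have nb: "h \<in> C" if h: "h \<in> F" "h \<noteq> e" "{e, h} \<in> edges X" for h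
  proof (rule ccontr)
    assume "h \<notin> C"
    have "connected_in X (C \<union> {e})"
      using connected_in_Un[OF C(2) connected_in_singleton[of e X] C(5), of e] C(3,6) sub by auto
    then have "Q (C \<union> {e}, h)" unfolding Q_def using C h \<open>h \<notin> C\<close> by auto
    from max[OF this] show False using C(4) finC by (simp add: ze)
  qed
  obtain f g where fg: "f \<in> F" "g \<in> F" "f \<noteq> g" "f \<noteq> e" "g \<noteq> e" "{e, f} \<in> edges X" "{e, g} \<in> edges X"
    using deg C(3) by blast
  have fC: "f \<in> C" and gC: "g \<in> C" using nb fg by auto
  let ?R = "{(x, y). x \<in> C - {f} \<and> y \<in> C - {f} \<and> {x, y} \<in> edges X}"
  define D where "D = {y. (g, y) \<in> ?R\<^sup>*}"
  have gD: "g \<in> D" unfolding D_def by auto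
  have D: "connected_in X D"
    unfolding D_def by (rule connected_in_component) (use gC fg C(1) sub in auto)
  have DC: "D \<subseteq> C - {f}"
  proof
    fix y assume "y \<in> D"
    then have "(g, y) \<in> ?R\<^sup>*" unfolding D_def by simp
    then show "y \<in> C - {f}" by (induction rule: rtrancl_induct) (use gC fg in auto)
  qed
  have "y \<in> D \<or> (\<exists>z\<in>D. {z, f} \<in> edges X)"
    if "(g, y) \<in> {(x, y). x \<in> C \<and> y \<in> C \<and> {x, y} \<in> edges X}\<^sup>*" for y
    using that
  proof (induction rule: rtrancl_induct)
    case base show ?case using gD by simp
  next
    case (step y z)
    then consider "y \<in> D" "z = f" | "y \<in> D" "z \<noteq> f" | "\<exists>z\<in>D. {z, f} \<in> edges X" by blast
    then show ?case
    proof cases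
      case 2
      then have "(y, z) \<in> ?R" using step.hyps(2) DC by auto
      then have "z \<in> D" using 2 unfolding D_def by (auto intro: rtrancl.rtrancl_into_rtrancl)
      then show ?thesis by simp
    qed (use step.hyps(2) in auto)
  qed
  then obtain z where zD: "z \<in> D" "{z, f} \<in> edges X"
    using C(2) fC gC DC unfolding connected_in_def by blast
  show ?thesis
  proof (rule exI[of _ "{e}"], rule exI[of _ "{f}"], rule exI[of _ D], intro conjI)
    show "connected_in X {e}" "connected_in X {f}"
      using C(3) fg(1) sub by (auto intro!: connected_in_singleton)
    show "\<exists>u\<in>{f}. \<exists>v\<in>D. {u, v} \<in> edges X" using zD by (auto simp: insert_commute)
  qed (use C DC fg gD D in auto)
qed

section \<open>Chords as pairs of reals and their crossing graph\<close>

definition crosses :: "real \<times> real \<Rightarrow> real \<times> real \<Rightarrow> bool" where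
  "crosses e f \<longleftrightarrow> fst e < fst f \<and> fst f < snd e \<and> snd e < snd f \<or>
     fst f < fst e \<and> fst e < snd f \<and> snd f < snd e"

definition chord_graph :: "(real \<times> real) set \<Rightarrow> (real \<times> real) ugraph" where
  "chord_graph E = \<lparr>verts = E, edges = {{e, f} | e f. e \<in> E \<and> f \<in> E \<and> crosses e f}\<rparr>"

lemma crosses_sym: "crosses e f \<longleftrightarrow> crosses f e"
  unfolding crosses_def by auto

lemma crosses_irrefl: "\<not> crosses e e"
  unfolding crosses_def by auto

lemma chord_graph_simps:
  "verts (chord_graph E) = E"
  "{e, f} \<in> edges (chord_graph E) \<longleftrightarrow> e \<in> E \<and> f \<in> E \<and> crosses e f"
proof -
  show "{e, f} \<in> edges (chord_graph E) \<longleftrightarrow> e \<in> E \<and> f \<in> E \<and> crosses e f"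
    unfolding chord_graph_def using crosses_sym[of e f]
    by (auto simp: doubleton_eq_iff simp del: split_paired_Ex)
qed (simp add: chord_graph_def)

text \<open>The circle is the real line closed up at infinity; each chord lists its ends in
  increasing order, so the arc "between" them is the one avoiding infinity.\<close>

locale chords =
  fixes V :: "real set" and E :: "(real \<times> real) set"
  assumes finV: "finite V" and neV: "V \<noteq> {}"
    and chord: "\<And>e. e \<in> E \<Longrightarrow> fst e \<in> V \<and> snd e \<in> V \<and> fst e < snd e"
begin

lemma finE: "finite E"
  by (rule finite_subset[of _ "V \<times> V"]) (use finV chord in \<open>auto simp: mem_Times_iff\<close>)

text \<open>A set \<^term>\<open>P\<close> of chords encodes the cell of a point of the disc: \<^term>\<open>e \<in> P\<close> if the point lies
  on the side of \<^term>\<open>e\<close> opposite to the arc between its end points. Then \<^term>\<open>far P e\<close> is the set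
  of vertices that \<^term>\<open>e\<close> separates from the point.\<close>

definition far :: "(real \<times> real) set \<Rightarrow> real \<times> real \<Rightarrow> real set" where
  "far P e = (if e \<in> P then {v \<in> V. fst e < v \<and> v < snd e} else {v \<in> V. v < fst e \<or> snd e < v})"

text \<open>Two constraints on a point strictly inside the disc: it cannot be under two chords with
  disjoint arcs, and it cannot be under a chord without being under every chord enclosing that one.
  They replace geometry in the whole argument about rings.\<close>

definition consistent :: "(real \<times> real) set \<Rightarrow> bool" where
  "consistent P \<longleftrightarrow>
     (\<forall>e\<in>E. \<forall>f\<in>E. snd e \<le> fst f \<longrightarrow> e \<in> P \<or> f \<in> P) \<and>
     (\<forall>e\<in>E. \<forall>f\<in>E. e \<noteq> f \<longrightarrow> fst e \<le> fst f \<longrightarrow> snd f \<le> snd e \<longrightarrow> e \<in> P \<longrightarrow> f \<in> P)"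

definition covers :: "(real \<times> real) set \<Rightarrow> (real \<times> real) set \<Rightarrow> bool" where
  "covers P D \<longleftrightarrow> V \<subseteq> (\<Union>e\<in>D. far P e)"

lemma endpoint_notin_far: "e \<in> E \<Longrightarrow> fst e \<notin> far P e \<and> snd e \<notin> far P e"
  using chord[of e] unfolding far_def by auto

text \<open>Without a crossing, \<open>e\<close> lies in the closed arc that \<open>f\<close> cuts
  off. Of the two arcs at \<open>e\<close>, one is inside this arc, and consistency rules out that
  the other one is cut off. Contrapositively, if \<open>far P e\<close> is maximal and an end of
  \<open>e\<close> lies in \<open>far P f\<close>, then \<open>e\<close> and \<open>f\<close>
  cross.\<close>

lemma far_psubset:
  assumes P: "consistent P" and e: "e \<in> E" and f: "f \<in> E" and ne: "e \<noteq> f" and nc: "\<not> crosses e f"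
    and x: "x = fst e \<or> x = snd e" and xf: "x \<in> far P f"
  shows "far P e \<subset> far P f"
proof -
  have lt: "fst e < snd e" "fst f < snd f" using chord e f by auto
  have c1: "e \<in> P \<or> f \<in> P" if "snd e \<le> fst f \<or> snd f \<le> fst e"
    using P e f that unfolding consistent_def by blast
  have c2: "f \<in> P" if "fst e \<le> fst f" "snd f \<le> snd e" "e \<in> P"
    using P e f ne that unfolding consistent_def by blast
  have c3: "e \<in> P" if "fst f \<le> fst e" "snd e \<le> snd f" "f \<in> P"
    using P e f ne that unfolding consistent_def by metis
  consider "snd e \<le> fst f" | "snd f \<le> fst e" | "fst e \<le> fst f" "snd f \<le> snd e"
    | "fst f \<le> fst e" "snd e \<le> snd f"
    using nc lt unfolding crosses_def by linarith
  then have "far P e \<subseteq> far P f"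
    by cases (use x xf lt c1 c2 c3 in \<open>auto simp: far_def split: if_splits\<close>)
  moreover have "x \<notin> far P e" using endpoint_notin_far[OF e] x by auto
  ultimately show ?thesis using xf by auto
qed

text \<open>Go from an uncovered vertex to the nearest covered one on the line. The chord that
  covers the latter but not the former has an end in between, and this end is covered, contradicting
  the choice of the nearest one.\<close>

lemma covers_of_endpoints:
  assumes C: "C \<subseteq> E" "C \<noteq> {}"
    and ends: "\<And>e. e \<in> C \<Longrightarrow> fst e \<in> (\<Union>e\<in>C. far P e) \<and> snd e \<in> (\<Union>e\<in>C. far P e)"
  shows "covers P C"
proof -
  define U where "U = (\<Union>e\<in>C. far P e)"
  have UV: "U \<subseteq> V" unfolding U_def far_def by auto
  have finU: "finite U" using UV finV finite_subset by auto
  have neU: "U \<noteq> {}" using ends C(2) unfolding U_def by blast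
  have "v \<in> U" if v: "v \<in> V" for v
  proof (rule ccontr)
    assume vU: "v \<notin> U"
    have vf: "v \<notin> far P e" "v \<noteq> fst e" "v \<noteq> snd e" "fst e \<in> U" "snd e \<in> U" if "e \<in> C" for e
      using that ends[OF that] vU unfolding U_def by auto
    show False
    proof (cases "\<exists>u\<in>U. v < u")
      case True
      define u where "u = Min {u \<in> U. v < u}"
      have u: "u \<in> U" "v < u" "\<And>w. w \<in> U \<Longrightarrow> v < w \<Longrightarrow> u \<le> w"
      proof -
        have "finite {u \<in> U. v < u}" "{u \<in> U. v < u} \<noteq> {}" using True finU by auto
        from Min_in[OF this] Min_le[OF this(1)] show "u \<in> U" "v < u" "\<And>w. w \<in> U \<Longrightarrow> v < w \<Longrightarrow> u \<le> w"
          unfolding u_def by auto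
      qed
      obtain e where e: "e \<in> C" "u \<in> far P e" using u(1) unfolding U_def by auto
      have lt: "fst e < snd e" using chord C e by auto
      show False
        using vf[OF e(1)] e(2) u(2) u(3)[OF vf(4)[OF e(1)]] u(3)[OF vf(5)[OF e(1)]] v lt
        unfolding far_def by (cases "e \<in> P") auto
    next
      case False
      define u where "u = Max {u \<in> U. u < v}"
      have "\<exists>u\<in>U. u < v" using False neU vU by (metis ex_in_conv linorder_less_linear)
      then have ne: "{u \<in> U. u < v} \<noteq> {}" by auto
      have "finite {u \<in> U. u < v}" using finU by auto
      from Max_in[OF this ne] Max_ge[OF this]
      have u: "u \<in> U" "u < v" "\<And>w. w \<in> U \<Longrightarrow> w < v \<Longrightarrow> w \<le> u"
        unfolding u_def by auto
      obtain e where e: "e \<in> C" "u \<in> far P e" using u(1) unfolding U_def by auto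
      have lt: "fst e < snd e" using chord C e by auto
      show False
        using vf[OF e(1)] e(2) u(2) u(3)[OF vf(4)[OF e(1)]] u(3)[OF vf(5)[OF e(1)]] v lt
        unfolding far_def by (cases "e \<in> P") auto
    qed
  qed
  then show ?thesis unfolding covers_def U_def by auto
qed

text \<open>Cutting the circle at \<^term>\<open>v\<close> turns the complements of the arcs \<^term>\<open>far P e\<close> that contain
  \<^term>\<open>v\<close> into intervals of a line.\<close>

lemma far_three_redundant:
  assumes v: "v \<in> V" and e: "{e1, e2, e3} \<subseteq> E"
    and vf: "v \<in> far P e1" "v \<in> far P e2" "v \<in> far P e3"
  shows "far P e1 \<subseteq> far P e2 \<union> far P e3 \<or> far P e2 \<subseteq> far P e1 \<union> far P e3 \<or>
    far P e3 \<subseteq> far P e1 \<union> far P e2"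
proof -
  \<comment> \<open>The key \<open>k\<close> lists the vertices in cyclic order starting just after
    \<open>v\<close>: those up to \<open>v\<close> are shifted beyond all others.\<close>
  define m where "m = Max V - Min V + 1"
  define k where "k u = (if v < u then u else u + m)" for u
  define l where "l e = min (k (fst e)) (k (snd e))" for e
  define r where "r e = max (k (fst e)) (k (snd e))" for e
  have far: "u \<in> far P e \<longleftrightarrow> \<not> (l e \<le> k u \<and> k u \<le> r e)" if "e \<in> E" "u \<in> V" "v \<in> far P e" "u \<noteq> v" for e u
  proof -
    have b: "Min V \<le> u" "u \<le> Max V" "Min V \<le> fst e" "fst e \<le> Max V" "Min V \<le> snd e" "snd e \<le> Max V"
      "fst e < snd e" "v \<noteq> fst e" "v \<noteq> snd e" "Min V \<le> v" "v \<le> Max V"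
      using that finV chord[of e] v endpoint_notin_far[of e P] by auto
    show ?thesis
      using that b unfolding far_def l_def r_def k_def m_def min_def max_def
      by (auto split: if_splits)
  qed
  have sub: "far P a \<subseteq> far P b \<union> far P c"
    if "a \<in> E" "b \<in> E" "c \<in> E" "v \<in> far P a" "v \<in> far P b" "v \<in> far P c"
      "l a \<le> l b \<or> l a \<le> l c" "r b \<le> r a \<or> r c \<le> r a" for a b c
  proof
    fix u assume u: "u \<in> far P a"
    have uV: "u \<in> V" using u unfolding far_def by (auto split: if_splits)
    show "u \<in> far P b \<union> far P c"
    proof (cases "u = v")
      case False
      then show ?thesis using far[OF that(1) uV that(4)] far[OF that(2) uV that(5)]
          far[OF that(3) uV that(6)] that(7,8) u by (metis UnI1 UnI2 order_trans)
    qed (use that(5) in simp)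
  qed
  \<comment> \<open>An arc is redundant if its complementary interval contains the intersection of
    the other two. This fails only for an interval with the strictly largest left end or the
    strictly smallest right end, so for at most two of the three.\<close>
  have "(l e1 \<le> l e2 \<or> l e1 \<le> l e3) \<and> (r e2 \<le> r e1 \<or> r e3 \<le> r e1) \<or>
    (l e2 \<le> l e1 \<or> l e2 \<le> l e3) \<and> (r e1 \<le> r e2 \<or> r e3 \<le> r e2) \<or>
    (l e3 \<le> l e1 \<or> l e3 \<le> l e2) \<and> (r e1 \<le> r e3 \<or> r e2 \<le> r e3)"
    by linarith
  then show ?thesis using sub[of e1 e2 e3] sub[of e2 e1 e3] sub[of e3 e1 e2] e vf by auto
qed

text \<open>What the minor argument uses of a cycle: connectedness and minimum degree two in the
  crossing graph.\<close>

definition ring :: "(real \<times> real) set \<Rightarrow> bool" where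
  "ring F \<longleftrightarrow> F \<noteq> {} \<and> F \<subseteq> E \<and> connected_in (chord_graph E) F \<and>
     (\<forall>e\<in>F. \<exists>f\<in>F. \<exists>g\<in>F. f \<noteq> g \<and> crosses e f \<and> crosses e g)"

text \<open>\<open>F\<close> is a minimal covering family among the chords with maximal arcs.
  Minimality and \<open>far_three_redundant\<close> bound the multiplicity by 2. Maximality makes a
  chord of \<open>D\<close> over an end of \<open>e\<close> cross \<open>e\<close>: this gives two
  crossings per chord, one for each end, and a crossing with every other covering family. A
  component of \<open>F\<close> covers all its ends, hence everything, so by minimality it is
  \<open>F\<close>.\<close>

lemma ex_ring:
  assumes P: "consistent P" and D: "D \<subseteq> E" and cov: "covers P D"
  obtains F where "F \<subseteq> D" "covers P F" "ring F"
    "\<And>v. v \<in> V \<Longrightarrow> card {e \<in> F. v \<in> far P e} \<le> 2"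
    "\<And>e F'. e \<in> F \<Longrightarrow> F' \<subseteq> D \<Longrightarrow> covers P F' \<Longrightarrow> e \<notin> F' \<Longrightarrow> \<exists>f\<in>F'. crosses e f"
proof -
  have finD: "finite D" using D finE finite_subset by auto
  define M where "M = {e \<in> D. \<forall>f\<in>D. \<not> far P e \<subset> far P f}"
  have up: "\<exists>m\<in>M. far P e \<subseteq> far P m" if e: "e \<in> D" for e
  proof -
    have "finite (far P ` D)" "far P e \<in> far P ` D" using finD e by auto
    then obtain W where W: "W \<in> far P ` D" "far P e \<subseteq> W" "\<forall>U\<in>far P ` D. W \<subseteq> U \<longrightarrow> W = U"
      using finite_has_maximal2[of "far P ` D" "far P e"] by metis
    then obtain m where "m \<in> D" "W = far P m" by auto
    with W show ?thesis unfolding M_def by (intro bexI[of _ m]) auto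
  qed
  have covM: "covers P M"
    unfolding covers_def
  proof
    fix v assume "v \<in> V"
    then obtain e where "e \<in> D" "v \<in> far P e" using cov unfolding covers_def by auto
    then show "v \<in> (\<Union>e\<in>M. far P e)" using up[of e] by auto
  qed
  have MD: "M \<subseteq> D" unfolding M_def by auto
  define A where "A = {F. F \<subseteq> M \<and> covers P F}"
  have finA: "finite A" 
    unfolding A_def by (rule finite_subset[of _ "Pow M"]) (use finite_subset[OF MD finD] in auto)
  have "M \<in> A" unfolding A_def using covM by auto
  then obtain F where F: "F \<in> A" and min: "\<And>F'. F' \<in> A \<Longrightarrow> F' \<subseteq> F \<Longrightarrow> F = F'"
    using finite_has_minimal[OF finA] by (metis empty_iff)
  have FM: "F \<subseteq> M" and covF: "covers P F" using F unfolding A_def by auto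
  have FD: "F \<subseteq> D" and FE: "F \<subseteq> E" using FM MD D by auto
  have finF: "finite F" using FD finD finite_subset by auto
  have irr: "\<not> far P e \<subseteq> (\<Union>f\<in>F - {e}. far P f)" if "e \<in> F" for e
  proof
    assume "far P e \<subseteq> (\<Union>f\<in>F - {e}. far P f)"
    then have "covers P (F - {e})" using covF unfolding covers_def by blast
    then have "F - {e} \<in> A" using FM unfolding A_def by auto
    from min[OF this] that show False by auto
  qed
  have neF: "F \<noteq> {}" using covF neV unfolding covers_def by auto
  have cr: "crosses e f" if "e \<in> F" "f \<in> D" "e \<noteq> f" "x = fst e \<or> x = snd e" "x \<in> far P f" for e f x
  proof (rule ccontr)
    assume "\<not> crosses e f"
    then have "far P e \<subset> far P f" using far_psubset[OF P _ _ that(3) _ that(4,5)] that FE D by auto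
    then show False using that(1,2) FM unfolding M_def by auto
  qed
  have last: "\<exists>f\<in>F'. crosses e f" if h: "e \<in> F" "F' \<subseteq> D" "covers P F'" "e \<notin> F'" for e F'
  proof -
    have "fst e \<in> V" using chord[of e] h FE by auto
    then obtain f where "f \<in> F'" "fst e \<in> far P f" using h(3) unfolding covers_def by auto
    then show ?thesis using cr[OF h(1), of f "fst e"] h by auto
  qed
  have nb: "\<exists>f\<in>F. x \<in> far P f \<and> crosses e f" if h: "e \<in> F" "x = fst e \<or> x = snd e" for e x
  proof -
    have "x \<in> V" using chord[of e] h FE by auto
    then obtain f where f: "f \<in> F" "x \<in> far P f" using covF unfolding covers_def by auto
    moreover have "f \<noteq> e" using endpoint_notin_far[of e P] f h FE by auto
    ultimately show ?thesis using cr[OF h(1) _ _ h(2)] FD by (metis subsetD)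
  qed
  have deg: "\<exists>f\<in>F. \<exists>g\<in>F. f \<noteq> g \<and> crosses e f \<and> crosses e g" if e: "e \<in> F" for e
  proof -
    obtain f where f: "f \<in> F" "fst e \<in> far P f" "crosses e f" using nb[OF e] by blast
    obtain g where g: "g \<in> F" "snd e \<in> far P g" "crosses e g" using nb[OF e] by blast
    \<comment> \<open>A chord crossing \<open>e\<close> separates its ends, so it cannot cut off
      both of them.\<close>
    have "f \<noteq> g" using f g unfolding far_def crosses_def by (auto split: if_splits)
    then show ?thesis using f g by blast
  qed
  have conn: "connected_in (chord_graph E) F"
  proof -
    obtain e0 where e0: "e0 \<in> F" using neF by auto
    let ?R = "{(x, y). x \<in> F \<and> y \<in> F \<and> {x, y} \<in> edges (chord_graph E)}"
    define C where "C = {y. (e0, y) \<in> ?R\<^sup>*}"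
    have C: "connected_in (chord_graph E) C"
      unfolding C_def by (rule connected_in_component) (use e0 FE in \<open>auto simp: chord_graph_simps\<close>)
    have CF: "C \<subseteq> F"
    proof
      fix y assume "y \<in> C"
      then have "(e0, y) \<in> ?R\<^sup>*" unfolding C_def by simp
      then show "y \<in> F" by (induction rule: rtrancl_induct) (use e0 in auto)
    qed
    have closed: "f \<in> C" if "e \<in> C" "f \<in> F" "crosses e f" for e f
    proof -
      have "(e, f) \<in> ?R" using that CF FE by (auto simp: chord_graph_simps)
      then show ?thesis using that(1) unfolding C_def by (auto intro: rtrancl.rtrancl_into_rtrancl)
    qed
    have "covers P C"
    proof (rule covers_of_endpoints)
      have "e0 \<in> C" unfolding C_def by simp
      then show "C \<noteq> {}" by auto
      fix e assume e: "e \<in> C"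
      then have "e \<in> F" using CF by auto
      then show "fst e \<in> (\<Union>e\<in>C. far P e) \<and> snd e \<in> (\<Union>e\<in>C. far P e)"
        using nb[of e "fst e"] nb[of e "snd e"] closed[OF e] by blast
    qed (use CF FE in auto)
    then have "C \<in> A" using CF FM unfolding A_def by auto
    then have "F = C" using min CF by auto
    then show ?thesis using C by simp
  qed
  have two: "card {e \<in> F. v \<in> far P e} \<le> 2" if v: "v \<in> V" for v
  proof (rule ccontr)
    assume "\<not> ?thesis"
    then have "3 \<le> card {e \<in> F. v \<in> far P e}" by simp
    then obtain T where T: "T \<subseteq> {e \<in> F. v \<in> far P e}" "card T = 3"
      by (meson obtain_subset_with_card_n)
    then obtain e1 e2 e3 where "T = {e1, e2, e3}" "e1 \<noteq> e2" "e1 \<noteq> e3" "e2 \<noteq> e3"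
      by (auto simp: card_3_iff)
    with T have *: "e1 \<in> F" "e2 \<in> F" "e3 \<in> F" "v \<in> far P e1" "v \<in> far P e2" "v \<in> far P e3"
      "e1 \<noteq> e2" "e1 \<noteq> e3" "e2 \<noteq> e3" by auto
    then have "far P e1 \<subseteq> far P e2 \<union> far P e3 \<or> far P e2 \<subseteq> far P e1 \<union> far P e3 \<or>
      far P e3 \<subseteq> far P e1 \<union> far P e2"
      using FE by (intro far_three_redundant[OF v]) auto
    moreover have "\<not> far P a \<subseteq> far P b \<union> far P c" if "a \<in> F" "b \<in> F - {a}" "c \<in> F - {a}" for a b c
      using irr[OF that(1)] that(2,3) by blast
    ultimately show False using * by (metis Diff_iff singletonD)
  qed
  show thesis
    by (rule that[OF FD covF _ two last]) (use neF FE conn deg in \<open>auto simp: ring_def\<close>)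
qed

text \<open>Each ring removed costs every vertex at most 2. After \<open>s\<close> removals either
  some vertex is free of the remaining chords, or they yield ring number \<open>s + 1\<close>; a
  later ring covers all vertices with chords that were still available earlier, hence crosses each
  earlier chord.\<close>

lemma nested_rings:
  assumes P: "consistent P" and D: "D \<subseteq> E"
  shows "(\<exists>v\<in>V. card {e \<in> D. v \<in> far P e} \<le> 2 * s) \<or>
    (\<exists>F. \<forall>i\<le>s. F i \<subseteq> D \<and> covers P (F i) \<and> ring (F i) \<and>
      (\<forall>j\<le>s. i < j \<longrightarrow> F i \<inter> F j = {} \<and> (\<forall>e\<in>F i. \<exists>f\<in>F j. crosses e f)))"
  using D
proof (induction s arbitrary: D)
  case (0 D)
  show ?case
  proof (cases "covers P D")
    case True
    obtain F where "F \<subseteq> D" "covers P F" "ring F"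
      by (rule ex_ring[OF P 0 True]) blast
    then show ?thesis by (intro disjI2 exI[of _ "\<lambda>_. F"]) auto
  next
    case False
    then obtain v where "v \<in> V" "{e \<in> D. v \<in> far P e} = {}" unfolding covers_def by auto
    then show ?thesis by (metis card.empty zero_le)
  qed
next
  case (Suc s D)
  show ?case
  proof (cases "covers P D")
    case True
    obtain F where F: "F \<subseteq> D" "covers P F" "ring F"
      and two: "\<And>v. v \<in> V \<Longrightarrow> card {e \<in> F. v \<in> far P e} \<le> 2"
      and cr: "\<And>e F'. e \<in> F \<Longrightarrow> F' \<subseteq> D \<Longrightarrow> covers P F' \<Longrightarrow> e \<notin> F' \<Longrightarrow> \<exists>f\<in>F'. crosses e f"
      by (rule ex_ring[OF P Suc.prems True]) blast
    have "D - F \<subseteq> E" using Suc.prems by auto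
    from Suc.IH[OF this] show ?thesis
    proof (elim disjE)
      assume "\<exists>v\<in>V. card {e \<in> D - F. v \<in> far P e} \<le> 2 * s"
      then obtain v where v: "v \<in> V" "card {e \<in> D - F. v \<in> far P e} \<le> 2 * s" by auto
      have "{e \<in> D. v \<in> far P e} = {e \<in> F. v \<in> far P e} \<union> {e \<in> D - F. v \<in> far P e}" using F by auto
      then have "card {e \<in> D. v \<in> far P e} \<le> 2 * Suc s"
        using card_Un_le[of "{e \<in> F. v \<in> far P e}" "{e \<in> D - F. v \<in> far P e}"] two[OF v(1)] v(2) by simp
      then show ?thesis using v(1) by blast
    next
      assume "\<exists>F'. \<forall>i\<le>s. F' i \<subseteq> D - F \<and> covers P (F' i) \<and> ring (F' i) \<and>
        (\<forall>j\<le>s. i < j \<longrightarrow> F' i \<inter> F' j = {} \<and> (\<forall>e\<in>F' i. \<exists>f\<in>F' j. crosses e f))"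
      then obtain F' where *: "\<forall>i\<le>s. F' i \<subseteq> D - F \<and> covers P (F' i) \<and> ring (F' i) \<and>
        (\<forall>j\<le>s. i < j \<longrightarrow> F' i \<inter> F' j = {} \<and> (\<forall>e\<in>F' i. \<exists>f\<in>F' j. crosses e f))"
        by (elim exE)
      have F': "F' i \<subseteq> D - F" "covers P (F' i)" "ring (F' i)"
        "j \<le> s \<Longrightarrow> i < j \<Longrightarrow> F' i \<inter> F' j = {} \<and> (\<forall>e\<in>F' i. \<exists>f\<in>F' j. crosses e f)"
        if "i \<le> s" for i j using * that by blast+
      have first: "F \<inter> F' j = {} \<and> (\<forall>e\<in>F. \<exists>f\<in>F' j. crosses e f)" if "j \<le> s" for j
        using cr[of _ "F' j"] F'(1,2)[OF that] by blast
      have sub: "F' i \<subseteq> D" if "i \<le> s" for i using F'(1)[OF that] by auto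
      define H where "H i = (case i of 0 \<Rightarrow> F | Suc j \<Rightarrow> F' j)" for i
      have H: "H 0 = F" "H (Suc j) = F' j" for j unfolding H_def by auto
      have "H i \<subseteq> D \<and> covers P (H i) \<and> ring (H i)" if "i \<le> Suc s" for i
        by (cases i) (use that F F'(2,3) sub in \<open>simp_all add: H\<close>)
      moreover have "H i \<inter> H j = {} \<and> (\<forall>e\<in>H i. \<exists>f\<in>H j. crosses e f)"
        if ij: "i < j" "j \<le> Suc s" for i j
      proof -
        obtain j' where j: "j = Suc j'" "j' \<le> s" using ij by (cases j) auto
        show ?thesis
        proof (cases i)
          case 0
          show ?thesis using first[OF j(2)] unfolding 0 j(1) H .
        next
          case (Suc i')
          then have "i' < j'" "i' \<le> s" using ij j by auto
          then show ?thesis using F'(4)[OF \<open>i' \<le> s\<close> j(2)] unfolding Suc j(1) H by blast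
        qed
      qed
      ultimately show ?thesis by (intro disjI2 exI[of _ H]) blast
    qed
  next
    case False
    then obtain v where "v \<in> V" "{e \<in> D. v \<in> far P e} = {}" unfolding covers_def by auto
    then show ?thesis by (metis card.empty zero_le)
  qed
qed

lemma ex_shallow_vertex:
  assumes P: "consistent P" and t: "t \<ge> 3"
    and no_minor: "\<not> has_minor (chord_graph E) (complete_graph t)"
  shows "\<exists>v\<in>V. card {e \<in> E. v \<in> far P e} \<le> 2 * (t - 3)"
proof (rule ccontr)
  assume "\<not> ?thesis"
  with nested_rings[OF P order_refl, of "t - 3"]
  obtain F where *: "\<forall>i\<le>t - 3. F i \<subseteq> E \<and> covers P (F i) \<and> ring (F i) \<and>
      (\<forall>j\<le>t - 3. i < j \<longrightarrow> F i \<inter> F j = {} \<and> (\<forall>e\<in>F i. \<exists>f\<in>F j. crosses e f))"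
    by (elim disjE exE) simp_all
  have F: "F i \<subseteq> E" "ring (F i)"
    "j \<le> t - 3 \<Longrightarrow> i < j \<Longrightarrow> F i \<inter> F j = {} \<and> (\<forall>e\<in>F i. \<exists>f\<in>F j. crosses e f)"
    if "i \<le> t - 3" for i j
    using * that by blast+
  let ?X = "chord_graph E"
  have F0: "finite (F 0)" "F 0 \<noteq> {}" "F 0 \<subseteq> E"
    using F(1,2)[of 0] finE finite_subset unfolding ring_def by auto
  have deg0: "\<forall>e\<in>F 0. \<exists>f\<in>F 0. \<exists>g\<in>F 0.
    f \<noteq> g \<and> f \<noteq> e \<and> g \<noteq> e \<and> {e, f} \<in> edges ?X \<and> {e, g} \<in> edges ?X"
  proof
    fix e assume h: "e \<in> F 0"
    have "ring (F 0)" using F(2)[of 0] by simp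
    then obtain f g where fg: "f \<in> F 0" "g \<in> F 0" "f \<noteq> g" "crosses e f" "crosses e g"
      using h unfolding ring_def by blast
    then show "\<exists>f\<in>F 0. \<exists>g\<in>F 0.
      f \<noteq> g \<and> f \<noteq> e \<and> g \<noteq> e \<and> {e, f} \<in> edges ?X \<and> {e, g} \<in> edges ?X"
      using h F0(3) crosses_irrefl
      unfolding chord_graph_simps(2) by (metis subsetD)
  qed
  obtain A B C where ABC: "A \<subseteq> F 0" "B \<subseteq> F 0" "C \<subseteq> F 0"
    "connected_in ?X A" "connected_in ?X B" "connected_in ?X C" "A \<inter> B = {}" "A \<inter> C = {}" "B \<inter> C = {}"
    "\<exists>u\<in>A. \<exists>v\<in>B. {u, v} \<in> edges ?X" "\<exists>u\<in>A. \<exists>v\<in>C. {u, v} \<in> edges ?X"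
    "\<exists>u\<in>B. \<exists>v\<in>C. {u, v} \<in> edges ?X"
  proof -
    have "F 0 \<subseteq> verts ?X" using F0(3) by (simp only: chord_graph_simps(1))
    from min_degree_two_imp_triangle_minor[OF F0(1,2) this deg0] show thesis
      by (elim exE conjE) (rule that)
  qed
  \<comment> \<open>The \<open>t - 2\<close> rings give \<open>t\<close> branch sets, three of them
    from \<open>F 0\<close>. Truncated subtraction makes \<open>i - 2\<close> equal to 0 for those
    three, so \<open>M i \<subseteq> F (i - 2)\<close> holds uniformly.\<close>
  define M where "M i = (if i = 0 then A else if i = 1 then B else if i = 2 then C else F (i - 2))" for i :: nat
  have conn: "connected_in ?X (M i)" if "i < t" for i
    using that ABC F(2)[of "i - 2"] unfolding M_def ring_def by auto
  have sub: "M i \<subseteq> F (i - 2)" for i unfolding M_def using ABC by auto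
  have lt: "M i \<inter> M j = {} \<and> (\<exists>u\<in>M i. \<exists>v\<in>M j. {u, v} \<in> edges ?X)"
    if h: "i < j" "j < t" for i j
  proof (cases "j \<ge> 3")
    case True
    then have ij: "i - 2 < j - 2" "j - 2 \<le> t - 3" "i - 2 \<le> t - 3" using h by auto
    have Mj: "M j = F (j - 2)" using True unfolding M_def by auto
    have "M i \<noteq> {}" using conn[of i] h unfolding connected_in_def by auto
    then obtain u where u: "u \<in> M i" by blast
    then obtain v where "v \<in> F (j - 2)" "crosses u v" using F(3)[OF ij(3,2,1)] sub by blast
    then have "{u, v} \<in> edges ?X" using u sub F(1)[OF ij(2)] F(1)[OF ij(3)]
      by (auto simp: chord_graph_simps)
    then show ?thesis using F(3)[OF ij(3,2,1)] sub[of i] u \<open>v \<in> F (j - 2)\<close> unfolding Mj by blast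
  next
    case False
    then consider "i = 0" "j = 1" | "i = 0" "j = 2" | "i = 1" "j = 2" using h by linarith
    then show ?thesis by cases (use ABC in \<open>auto simp: M_def\<close>)
  qed
  have "has_minor ?X (complete_graph t)"
    unfolding has_minor_def
  proof (intro exI[of _ M] conjI ballI impI)
    fix i j assume ij: "i \<in> verts (complete_graph t)" "j \<in> verts (complete_graph t)"
    then have t: "i < t" "j < t" by (auto simp: complete_graph_def)
    show "M i \<inter> M j = {}" if "i \<noteq> j"
      using lt[of i j] lt[of j i] t that by (cases "i < j") auto
    show "\<exists>u\<in>M i. \<exists>v\<in>M j. {u, v} \<in> edges ?X" if "{i, j} \<in> edges (complete_graph t)"
    proof -
      have "i \<noteq> j" using that by (auto simp: complete_graph_def doubleton_eq_iff)
      then show ?thesis using lt[of i j] lt[of j i] t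
        by (cases "i < j") (auto simp: insert_commute, metis insert_commute)
    qed
  qed (use conn in \<open>auto simp: complete_graph_def\<close>)
  then show False using no_minor by simp
qed

end

section \<open>Cells of the arrangement of chords\<close>

text \<open>Brouwer's theorem for the map \<open>z - (f z, g z)\<close> clamped to the rectangle. At
  a fixed point a coordinate inside its interval was not moved; on a side, the sign condition
  excludes any push outwards, so the function vanishes there too.\<close>

lemma poincare_miranda:
  fixes f g :: "real \<times> real \<Rightarrow> real"
  assumes ab: "a \<le> b" and cd: "c \<le> d"
    and cont: "continuous_on ({a..b} \<times> {c..d}) f" "continuous_on ({a..b} \<times> {c..d}) g"
    and f: "\<And>u. u \<in> {c..d} \<Longrightarrow> f (a, u) \<le> 0 \<and> 0 \<le> f (b, u)"
    and g: "\<And>s. s \<in> {a..b} \<Longrightarrow> g (s, c) \<le> 0 \<and> 0 \<le> g (s, d)"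
  shows "\<exists>z\<in>{a..b} \<times> {c..d}. f z = 0 \<and> g z = 0"
proof -
  let ?S = "{a..b} \<times> {c..d}"
  define h where "h z = (max a (min b (fst z - f z)), max c (min d (snd z - g z)))" for z
  have S: "compact ?S" "convex ?S" "?S \<noteq> {}"
    using ab cd by (auto intro: compact_Times convex_Times)
  have "continuous_on ?S h"
    unfolding h_def by (intro continuous_intros cont)
  moreover have "h \<in> ?S \<rightarrow> ?S" using ab cd unfolding h_def by auto
  ultimately obtain z where z: "z \<in> ?S" "h z = z"
    using brouwer[OF S] by metis
  obtain s u where zsu: "z = (s, u)" by (cases z)
  have su: "s \<in> {a..b}" "u \<in> {c..d}" "max a (min b (s - f z)) = s" "max c (min d (u - g z)) = u"
    using z unfolding zsu h_def by auto
  have "f z = 0"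
    using su(1,3) f[OF su(2)] unfolding zsu by (auto simp: max_def min_def split: if_splits)
  moreover have "g z = 0"
    using su(2,4) g[OF su(1)] unfolding zsu by (auto simp: max_def min_def split: if_splits)
  ultimately show ?thesis using z(1) by blast
qed

text \<open>Triangulates the part of the polygon on the arc from \<open>p\<close> to
  \<open>q\<close>; in the second rule, \<open>r\<close> is the apex of the triangle on the base
  \<open>pq\<close>.\<close>

inductive triangulated :: "real set \<Rightarrow> (real \<Rightarrow> real \<Rightarrow> bool) \<Rightarrow> real \<Rightarrow> real \<Rightarrow> bool" for V T where
  edge: "p \<in> V \<Longrightarrow> q \<in> V \<Longrightarrow> p < q \<Longrightarrow> (\<And>v. v \<in> V \<Longrightarrow> \<not> (p < v \<and> v < q)) \<Longrightarrow> T p q \<Longrightarrow>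
    triangulated V T p q"
| split: "triangulated V T p r \<Longrightarrow> triangulated V T r q \<Longrightarrow> T p q \<Longrightarrow> triangulated V T p q"

text \<open>The vertices are placed on the parabola $y = x^2$; then \<^term>\<open>line_form e\<close>
  vanishes on the line spanned by the chord \<^term>\<open>e\<close> and is negative below it.\<close>

definition line_form :: "real \<times> real \<Rightarrow> real \<times> real \<Rightarrow> real" where
  "line_form e x = snd x - (fst e + snd e) * fst x + fst e * snd e"

definition vpt :: "real \<Rightarrow> real \<times> real" where
  "vpt v = (v, v\<^sup>2)"

lemma line_form_vpt: "line_form e (vpt u) = (u - fst e) * (u - snd e)"
  unfolding line_form_def vpt_def by (simp add: algebra_simps power2_eq_square)

lemma line_form_affine:
  "line_form e (x + s *\<^sub>R (y - x)) = (1 - s) * line_form e x + s * line_form e y"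
  unfolding line_form_def by (simp add: algebra_simps)

lemma line_form_height:
  "line_form e x = (snd x - (fst x)\<^sup>2) + (fst x - fst e) * (fst x - snd e)"
  unfolding line_form_def by (simp add: algebra_simps power2_eq_square)

text \<open>The height over the parabola plays the role of the distance to the circle. On a segment
  towards a boundary point it stays positive until \<open>s = 1\<close>.\<close>

lemma height_segment:
  "snd (x + s *\<^sub>R (vpt u - x)) - (fst (x + s *\<^sub>R (vpt u - x)))\<^sup>2 =
    (1 - s) * (snd x - (fst x)\<^sup>2) + s * (1 - s) * (fst x - u)\<^sup>2"
  unfolding vpt_def by (simp add: algebra_simps power2_eq_square)

lemma continuous_line_form: "continuous_on UNIV (line_form e)"
  unfolding line_form_def by (intro continuous_intros)

lemma below_line_imp_between:
  assumes "(fst x)\<^sup>2 < snd x" "line_form e x \<le> 0" "fst e < snd e"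
  shows "fst e < fst x \<and> fst x < snd e"
proof -
  have "(fst x - fst e) * (fst x - snd e) < 0" using assms line_form_height[of e x] by linarith
  then show ?thesis using assms(3) by (auto simp: mult_less_0_iff)
qed

text \<open>Over the open arc of the inner chord, where \<open>x\<close> must lie, the outer chord
  runs strictly above the inner one.\<close>

lemma line_form_nested:
  assumes x: "(fst x)\<^sup>2 < snd x" and f: "line_form f x \<le> 0" "fst f < snd f"
    and nest: "fst e \<le> fst f" "snd f \<le> snd e" "e \<noteq> f"
  shows "line_form e x < 0"
proof -
  have X: "fst f < fst x" "fst x < snd f" using below_line_imp_between[OF x f] by auto
  have "line_form e x - line_form f x
      = - ((fst f - fst e) * (snd e - fst x) + (fst x - fst f) * (snd e - snd f))"
    unfolding line_form_def by (simp add: algebra_simps)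
  moreover have "0 < (fst f - fst e) * (snd e - fst x) + (fst x - fst f) * (snd e - snd f)"
  proof (cases "fst e = fst f")
    case True
    then have "snd f < snd e" using nest by (metis order_le_less prod.expand)
    then show ?thesis using True X by simp
  next
    case False
    then have "0 < (fst f - fst e) * (snd e - fst x)" using nest X by auto
    moreover have "0 \<le> (fst x - fst f) * (snd e - snd f)" using nest X by auto
    ultimately show ?thesis by linarith
  qed
  ultimately show ?thesis using f(1) by linarith
qed

lemma line_form_vpt_nonpos: "fst e < snd e \<Longrightarrow> line_form e (vpt u) \<le> 0 \<longleftrightarrow> fst e \<le> u \<and> u \<le> snd e"
  unfolding line_form_vpt by (auto simp: mult_le_0_iff)

lemma line_form_vpt_nonneg: "fst e < snd e \<Longrightarrow> 0 \<le> line_form e (vpt u) \<longleftrightarrow> u \<le> fst e \<or> snd e \<le> u"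
  unfolding line_form_vpt by (auto simp: zero_le_mult_iff)

section \<open>Depths, nearest vertices and good diagonals\<close>

context chords
begin

text \<open>Cells are closed: a point on the line of \<open>e\<close> belongs to cells with either
  choice for \<open>e\<close>. This allows cells with different labels to share a point.\<close>

definition cell :: "(real \<times> real) set \<Rightarrow> (real \<times> real) set" where
  "cell R = {x. \<forall>e\<in>E. (e \<in> R \<longrightarrow> 0 \<le> line_form e x) \<and> (e \<notin> R \<longrightarrow> line_form e x \<le> 0)}"

definition depth :: "(real \<times> real) set \<Rightarrow> real \<Rightarrow> nat" where
  "depth R v = card {e \<in> E. v \<in> far R e}"

definition nearest :: "(real \<times> real) set \<Rightarrow> real \<Rightarrow> bool" where
  "nearest R p \<longleftrightarrow> p \<in> V \<and> (\<forall>v\<in>V. depth R p \<le> depth R v)"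

text \<open>The common point has to be strictly inside, because only there are both cells
  consistent.\<close>

definition witnessed :: "real \<Rightarrow> real \<Rightarrow> bool" where
  "witnessed p q \<longleftrightarrow> (\<exists>x P Q. (fst x)\<^sup>2 < snd x \<and> x \<in> cell P \<and> x \<in> cell Q \<and> nearest P p \<and> nearest Q q)"

lemma cell_conv:
  "x \<in> cell R \<Longrightarrow> y \<in> cell R \<Longrightarrow> 0 \<le> s \<Longrightarrow> s \<le> 1 \<Longrightarrow> x + s *\<^sub>R (y - x) \<in> cell R"
  unfolding cell_def mem_Collect_eq line_form_affine
  by (metis add_nonneg_nonneg add_nonpos_nonpos diff_ge_0_iff_ge mult_nonneg_nonneg mult_nonneg_nonpos)

lemma closed_cell: "closed (cell R)"
proof -
  have "cell R = (\<Inter>e\<in>E. if e \<in> R then {x. 0 \<le> line_form e x} else {x. line_form e x \<le> 0})"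
    unfolding cell_def by (auto split: if_splits)
  moreover have "closed {x. 0 \<le> line_form e x}" "closed {x. line_form e x \<le> 0}" for e
    using closed_Collect_le[OF continuous_on_const continuous_line_form]
      closed_Collect_le[OF continuous_line_form continuous_on_const] by auto
  ultimately show ?thesis by (auto intro!: closed_INT)
qed

lemma ex_cell: "\<exists>R\<subseteq>E. x \<in> cell R"
  by (intro exI[of _ "{e \<in> E. 0 \<le> line_form e x}"]) (auto simp: cell_def)

lemma ex_nearest: "\<exists>v. nearest R v"
  using ex_min_if_finite[of "depth R ` V"] finV neV unfolding nearest_def
  by (metis (no_types, lifting) arg_min_if_finite(1) arg_min_least)

lemma depth_sum: "depth R v = (\<Sum>e\<in>E. of_bool (v \<in> far R e))"
  unfolding depth_def using finE by (simp add: Int_def of_bool_def sum.If_cases)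

text \<open>Chord by chord, passing from \<open>P\<close> to \<open>R\<close> is at least as
  favourable to \<open>p\<close> as to \<open>v\<close>; stated with sums, since depths are natural
  numbers.\<close>

lemma depth_exchange:
  assumes "\<And>e. e \<in> E \<Longrightarrow> of_bool (p \<in> far R e) + of_bool (v \<in> far P e)
    \<le> of_bool (p \<in> far P e) + (of_bool (v \<in> far R e) :: nat)"
  shows "depth R p + depth P v \<le> depth P p + depth R v"
  unfolding depth_sum sum.distrib[symmetric] by (rule sum_mono) (rule assms)

lemma depth_zero_iff: "depth R v = 0 \<longleftrightarrow> (\<forall>e\<in>E. v \<notin> far R e)"
  unfolding depth_def using finE by auto

lemma nearest_depth_zero: "v \<in> V \<Longrightarrow> depth R v = 0 \<Longrightarrow> nearest R v"
  unfolding nearest_def by auto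

lemma depth_zero_vpt_cell:
  assumes "v \<in> V" "depth R v = 0"
  shows "vpt v \<in> cell R"
  unfolding cell_def
proof (intro CollectI ballI)
  fix e assume e: "e \<in> E"
  then have "v \<notin> far R e" using assms(2) depth_zero_iff by auto
  then show "(e \<in> R \<longrightarrow> 0 \<le> line_form e (vpt v)) \<and> (e \<notin> R \<longrightarrow> line_form e (vpt v) \<le> 0)"
    using line_form_vpt_nonpos[of e v] line_form_vpt_nonneg[of e v] chord[OF e] assms(1)
    unfolding far_def by (auto split: if_splits)
qed

lemma consistent_cell:
  assumes x: "(fst x)\<^sup>2 < snd x" and R: "x \<in> cell R"
  shows "consistent R"
  unfolding consistent_def
proof (intro conjI ballI impI)
  fix e f assume ef: "e \<in> E" "f \<in> E" "snd e \<le> fst f"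
  show "e \<in> R \<or> f \<in> R"
  proof (rule ccontr)
    assume "\<not> (e \<in> R \<or> f \<in> R)"
    then have "line_form e x \<le> 0" "line_form f x \<le> 0" using R ef unfolding cell_def by auto
    then show False using below_line_imp_between[OF x, of e] below_line_imp_between[OF x, of f]
        chord[OF ef(1)] chord[OF ef(2)] ef(3) by auto
  qed
next
  fix e f assume ef: "e \<in> E" "f \<in> E" "e \<noteq> f" "fst e \<le> fst f" "snd f \<le> snd e" "e \<in> R"
  show "f \<in> R"
  proof (rule ccontr)
    assume "f \<notin> R"
    then have "line_form e x \<ge> 0" "line_form f x \<le> 0" using R ef unfolding cell_def by auto
    then show False using line_form_nested[OF x _ _ ef(4,5,3)] chord[OF ef(2)] by auto
  qed
qed

text \<open>A crossing chord has \<open>p\<close> and \<open>q\<close> on different sides. If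
  \<open>P\<close> and \<open>Q\<close> agree on it, it is counted in the depth of \<open>p\<close>
  in \<open>P\<close> or of \<open>q\<close> in \<open>Q\<close>; if they disagree, it passes
  through \<open>x\<close>, which happens at most twice.\<close>

lemma witnessed_thin:
  assumes t: "t \<ge> 3" and no_minor: "\<not> has_minor (chord_graph E) (complete_graph t)"
    and generic: "\<And>x. (fst x)\<^sup>2 < snd x \<Longrightarrow> card {e \<in> E. line_form e x = 0} \<le> 2"
    and w: "witnessed p q" and pq: "p < q"
  shows "card {e \<in> E. fst e < p \<and> p < snd e \<and> snd e < q \<or> p < fst e \<and> fst e < q \<and> q < snd e} \<le> 4 * t - 10"
proof -
  obtain x P Q where x: "(fst x)\<^sup>2 < snd x" and P: "x \<in> cell P" "nearest P p"
    and Q: "x \<in> cell Q" "nearest Q q"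
    using w unfolding witnessed_def by blast
  have bound: "depth R v \<le> 2 * (t - 3)" if R: "x \<in> cell R" "nearest R v" for R v
    using ex_shallow_vertex[OF consistent_cell[OF x R(1)] t no_minor] R(2)
    unfolding nearest_def depth_def[symmetric] by (meson order_trans)
  have pV: "p \<in> V" "q \<in> V" using P Q unfolding nearest_def by auto
  let ?S = "{e \<in> E. fst e < p \<and> p < snd e \<and> snd e < q \<or> p < fst e \<and> fst e < q \<and> q < snd e}"
  let ?A = "{e \<in> E. p \<in> far P e}" and ?B = "{e \<in> E. q \<in> far Q e}" and ?C = "{e \<in> E. line_form e x = 0}"
  have "?S \<subseteq> ?A \<union> ?B \<union> ?C"
  proof
    fix e assume e: "e \<in> ?S"
    show "e \<in> ?A \<union> ?B \<union> ?C"
    proof (cases "e \<in> P \<longleftrightarrow> e \<in> Q")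
      case True
      then show ?thesis using e pV unfolding far_def by auto
    next
      case False
      then have "line_form e x = 0" using P Q e unfolding cell_def by fastforce
      then show ?thesis using e by auto
    qed
  qed
  then have "card ?S \<le> card (?A \<union> ?B \<union> ?C)" by (rule card_mono[rotated]) (use finE in auto)
  also have "\<dots> \<le> card ?A + card ?B + card ?C"
    by (meson add_mono card_Un_le le_refl order_trans)
  also have "\<dots> \<le> 2 * (t - 3) + 2 * (t - 3) + 2"
    using bound[OF P] bound[OF Q] generic[OF x] unfolding depth_def by linarith
  finally show ?thesis using t by simp
qed

text \<open>On the way from \<open>x\<close> straight to \<open>p\<close>, a side changes only for
  chords separating \<open>p\<close> from the cell \<open>P\<close>. Each change lowers the depth of
  \<open>p\<close> by one and that of any other vertex by at most one.\<close>

lemma segment_nearest: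
  assumes x: "x \<in> cell P" and p: "nearest P p" and s: "0 \<le> s" "s \<le> 1"
    and y: "y = x + s *\<^sub>R (vpt p - x)"
  shows "\<exists>R\<subseteq>E. y \<in> cell R \<and> nearest R p"
proof -
  \<comment> \<open>Ties at \<open>y\<close> are resolved as in \<open>P\<close>, so that no
    unnecessary change occurs.\<close>
  define R where "R = {e \<in> E. 0 < line_form e y \<or> line_form e y = 0 \<and> e \<in> P}"
  have yR: "y \<in> cell R" unfolding cell_def R_def by auto
  have change: "p \<in> far P e \<and> p \<notin> far R e" if e: "e \<in> E" and ch: "(e \<in> P) \<noteq> (e \<in> R)" for e
  proof -
    have ly: "line_form e y = (1 - s) * line_form e x + s * line_form e (vpt p)"
      unfolding y by (rule line_form_affine)
    have pV: "p \<in> V" using p unfolding nearest_def by auto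
    have lt: "fst e < snd e" using chord[OF e] by auto
    show ?thesis
    proof (cases "e \<in> P")
      case True
      then have "line_form e y < 0" using ch e unfolding R_def by auto
      moreover have "0 \<le> (1 - s) * line_form e x" using True e x s unfolding cell_def by auto
      ultimately have "s * line_form e (vpt p) < 0" using ly by linarith
      then have "line_form e (vpt p) < 0" using s by (simp add: mult_less_0_iff)
      then have "fst e < p \<and> p < snd e"
        using line_form_vpt_nonneg[OF lt, of p] by linarith
      then show ?thesis using True ch pV unfolding far_def by auto
    next
      case False
      then have "line_form e y > 0" using ch e unfolding R_def by auto
      moreover have "(1 - s) * line_form e x \<le> 0"
        using False e x s unfolding cell_def by (auto intro!: mult_nonneg_nonpos)
      ultimately have "s * line_form e (vpt p) > 0" using ly by linarith
      then have "line_form e (vpt p) > 0" using s by (simp add: zero_less_mult_iff)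
      then have "p < fst e \<or> snd e < p"
        using line_form_vpt_nonpos[OF lt, of p] by linarith
      then show ?thesis using False ch pV lt unfolding far_def by auto
    qed
  qed
  have "depth R p \<le> depth R v" if v: "v \<in> V" for v
  proof -
    have "depth R p + depth P v \<le> depth P p + depth R v"
    proof (rule depth_exchange)
      fix e assume e: "e \<in> E"
      show "of_bool (p \<in> far R e) + of_bool (v \<in> far P e)
        \<le> of_bool (p \<in> far P e) + (of_bool (v \<in> far R e) :: nat)"
      proof (cases "(e \<in> P) = (e \<in> R)")
        case True
        then show ?thesis unfolding far_def by auto
      next
        case False
        then show ?thesis using change[OF e] by auto
      qed
    qed
    then show ?thesis using p v unfolding nearest_def by fastforce
  qed
  then have "nearest R p" using p unfolding nearest_def by auto
  then show ?thesis using yR by (intro exI[of _ R]) (auto simp: R_def)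
qed

text \<open>Moving from \<^term>\<open>x\<close> towards the arc between \<^term>\<open>p\<close> and \<^term>\<open>q\<close>, a vertex \<^term>\<open>r\<close> outside
  this arc cannot gain on both \<^term>\<open>p\<close> and \<^term>\<open>q\<close>: chords responsible for it would cut off
  disjoint caps around \<^term>\<open>p\<close> and \<^term>\<open>q\<close> that both contain \<^term>\<open>x\<close>.\<close>

lemma outside_vertex_not_nearer:
  assumes x: "(fst x)\<^sup>2 < snd x" "x \<in> cell P" "x \<in> cell Q" and y: "y \<in> cell R"
    and yx: "y = x + s *\<^sub>R (vpt u - x)" "0 < s" "s \<le> 1"
    and u: "p < u" "u < q" and r: "r < p \<or> q < r" and V: "p \<in> V" "q \<in> V" "r \<in> V"
  shows "depth R p + depth P r \<le> depth P p + depth R r \<or> depth R q + depth Q r \<le> depth Q q + depth R r"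
proof (rule ccontr)
  assume neg: "\<not> ?thesis"
  have "\<exists>e\<in>E. \<not> of_bool (p \<in> far R e) + of_bool (r \<in> far P e)
    \<le> of_bool (p \<in> far P e) + (of_bool (r \<in> far R e) :: nat)"
    using neg depth_exchange[of p R r P] by blast
  then obtain e where e: "e \<in> E" and ev: "\<not> of_bool (p \<in> far R e) + of_bool (r \<in> far P e)
    \<le> of_bool (p \<in> far P e) + (of_bool (r \<in> far R e) :: nat)" by blast
  have "\<exists>f\<in>E. \<not> of_bool (q \<in> far R f) + of_bool (r \<in> far Q f)
    \<le> of_bool (q \<in> far Q f) + (of_bool (r \<in> far R f) :: nat)"
    using neg depth_exchange[of q R r Q] by blast
  then obtain f where f: "f \<in> E" and fv: "\<not> of_bool (q \<in> far R f) + of_bool (r \<in> far Q f)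
    \<le> of_bool (q \<in> far Q f) + (of_bool (r \<in> far R f) :: nat)" by blast
  \<comment> \<open>A chord that breaks the termwise inequality changes sides. Either
    \<open>x\<close> is on or above it and its arc contains \<open>u\<close> and \<open>r\<close>
    but not \<open>w\<close>, or \<open>x\<close> is on or below it and its arc contains
    \<open>w\<close> but neither \<open>u\<close> nor \<open>r\<close> (up to ends).\<close>
  have data: "(g \<notin> R \<and> 0 \<le> line_form g x \<and> fst g \<le> u \<and> u \<le> snd g \<and> (w \<le> fst g \<or> snd g \<le> w)
        \<and> fst g \<le> r \<and> r \<le> snd g) \<or>
      (g \<in> R \<and> line_form g x \<le> 0 \<and> fst g < fst x \<and> fst x < snd g \<and> (u \<le> fst g \<or> snd g \<le> u)
        \<and> fst g \<le> w \<and> w \<le> snd g \<and> (r \<le> fst g \<or> snd g \<le> r))"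
    if g: "g \<in> E" and W: "w \<in> V" and xS: "x \<in> cell S"
      and gv: "\<not> of_bool (w \<in> far R g) + of_bool (r \<in> far S g)
        \<le> of_bool (w \<in> far S g) + (of_bool (r \<in> far R g) :: nat)" for g w S
  proof -
    have lt: "fst g < snd g" using chord[OF g] by auto
    have v1: "\<not> (w \<in> far S g \<and> w \<notin> far R g)" and v2: "\<not> (r \<in> far R g \<and> r \<notin> far S g)"
      using gv by (auto simp: of_bool_def split: if_splits)
    have ly: "line_form g y = (1 - s) * line_form g x + s * line_form g (vpt u)"
      unfolding yx by (rule line_form_affine)
    consider "g \<in> S" "g \<notin> R" | "g \<notin> S" "g \<in> R"
      using gv unfolding far_def by (cases "g \<in> S"; cases "g \<in> R") auto
    then show ?thesis
    proof cases
      case 1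
      have l: "0 \<le> line_form g x" "line_form g y \<le> 0" using 1 g xS y unfolding cell_def by auto
      moreover have "0 \<le> (1 - s) * line_form g x" using l(1) yx(3) by auto
      ultimately have "s * line_form g (vpt u) \<le> 0" using ly by linarith
      then have "line_form g (vpt u) \<le> 0" using yx(2) by (simp add: mult_le_0_iff)
      then have "fst g \<le> u \<and> u \<le> snd g" using line_form_vpt_nonpos[OF lt] by blast
      moreover have "\<not> (fst g < w \<and> w < snd g)" "\<not> (r < fst g \<or> snd g < r)"
        using v1 v2 1 W V(3) lt unfolding far_def by auto
      ultimately show ?thesis using 1 l by auto
    next
      case 2
      have l: "line_form g x \<le> 0" "0 \<le> line_form g y" using 2 g xS y unfolding cell_def by auto
      moreover have "(1 - s) * line_form g x \<le> 0" using l(1) yx(3) by (auto intro: mult_nonneg_nonpos)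
      ultimately have "0 \<le> s * line_form g (vpt u)" using ly by linarith
      then have "0 \<le> line_form g (vpt u)" using yx(2) by (simp add: zero_le_mult_iff)
      then have "u \<le> fst g \<or> snd g \<le> u" using line_form_vpt_nonneg[OF lt] by blast
      moreover have "\<not> (w < fst g \<or> snd g < w)" "\<not> (fst g < r \<and> r < snd g)"
        using v1 v2 2 W V(3) lt unfolding far_def by auto
      ultimately show ?thesis using 2 l below_line_imp_between[OF x(1) l(1) lt] by auto
    qed
  qed
  note de = data[OF e V(1) x(2) ev] and df = data[OF f V(2) x(3) fv]
  have n1: "e = f" if "fst e \<le> fst f" "snd f \<le> snd e" "line_form f x \<le> 0" "0 \<le> line_form e x"
    using line_form_nested[OF x(1) that(3) _ that(1,2)] chord[OF f] that(4) by fastforce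
  have n2: "e = f" if "fst f \<le> fst e" "snd e \<le> snd f" "line_form e x \<le> 0" "0 \<le> line_form f x"
    using line_form_nested[OF x(1) that(3) _ that(1,2)] chord[OF e] that(4) by fastforce
  have lt: "fst e < snd e" "fst f < snd f" using chord e f by auto
  from r show False
  proof
    assume r: "q < r"
    \<comment> \<open>As \<open>u < q < r\<close>, the chord \<open>f\<close> must be of the second
      kind, with its arc between \<open>u\<close> and \<open>r\<close>. Then \<open>e\<close> either
      encloses \<open>f\<close> although \<open>x\<close> is not below \<open>e\<close>, or spans an
      arc to the left of \<open>u\<close> that should contain the abscissa of \<open>x\<close>. The
      case \<open>r < p\<close> is the mirror image.\<close>
    from df r u have f1: "f \<in> R" "line_form f x \<le> 0" "fst f < fst x" "u \<le> fst f" "snd f \<le> r" by auto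
    from de show False
    proof
      assume "e \<notin> R \<and> 0 \<le> line_form e x \<and> fst e \<le> u \<and> u \<le> snd e \<and> (p \<le> fst e \<or> snd e \<le> p)
        \<and> fst e \<le> r \<and> r \<le> snd e"
      then show False using n1 f1 by auto
    next
      assume "e \<in> R \<and> line_form e x \<le> 0 \<and> fst e < fst x \<and> fst x < snd e \<and> (u \<le> fst e \<or> snd e \<le> u)
        \<and> fst e \<le> p \<and> p \<le> snd e \<and> (r \<le> fst e \<or> snd e \<le> r)"
      then show False using f1 u by auto
    qed
  next
    assume r: "r < p"
    from de r u have e1: "e \<in> R" "line_form e x \<le> 0" "fst x < snd e" "snd e \<le> u" "r \<le> fst e" by auto
    from df show False
    proof
      assume "f \<notin> R \<and> 0 \<le> line_form f x \<and> fst f \<le> u \<and> u \<le> snd f \<and> (q \<le> fst f \<or> snd f \<le> q)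
        \<and> fst f \<le> r \<and> r \<le> snd f"
      then show False using n2 e1 by auto
    next
      assume "f \<in> R \<and> line_form f x \<le> 0 \<and> fst f < fst x \<and> fst x < snd f \<and> (u \<le> fst f \<or> snd f \<le> u)
        \<and> fst f \<le> q \<and> q \<le> snd f \<and> (r \<le> fst f \<or> snd f \<le> r)"
      then show False using e1 u by auto
    qed
  qed
qed

text \<open>Supplies a vertex in the open arc that no chord end separates from \<open>u\<close>,
  even when \<open>u\<close> is \<open>p\<close> or \<open>q\<close>: the last one up to
  \<open>u\<close>, or the first of the arc if there is none.\<close>

lemma ex_adjacent_vertex:
  assumes w: "w \<in> V" "p < w" "w < q" and u: "p \<le> u" "u \<le> q"
  obtains r where "r \<in> V" "p < r" "r < q" "\<And>v. v \<in> V \<Longrightarrow> \<not> (u < v \<and> v < r) \<and> \<not> (r < v \<and> v < u)"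
    "u \<in> V \<Longrightarrow> p < u \<Longrightarrow> u < q \<Longrightarrow> r = u"
proof (cases "\<exists>v\<in>V. p < v \<and> v < q \<and> v \<le> u")
  case True
  let ?M = "{v \<in> V. p < v \<and> v < q \<and> v \<le> u}"
  have M: "finite ?M" "?M \<noteq> {}" using finV True by auto
  note in_M = Max_in[OF M] and ge_M = Max_ge[OF M(1)]
  show thesis
  proof (rule that[of "Max ?M"])
    fix v assume "v \<in> V"
    then show "\<not> (u < v \<and> v < Max ?M) \<and> \<not> (Max ?M < v \<and> v < u)"
      using in_M ge_M[of v] u by auto
  next
    assume "u \<in> V" "p < u" "u < q"
    then show "Max ?M = u" using in_M ge_M[of u] by auto
  qed (use in_M in auto)
next
  case False
  let ?M = "{v \<in> V. p < v \<and> v < q}"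
  have M: "finite ?M" "?M \<noteq> {}" using finV w by auto
  note in_M = Min_in[OF M] and le_M = Min_le[OF M(1)]
  show thesis
  proof (rule that[of "Min ?M"])
    fix v assume "v \<in> V"
    then show "\<not> (u < v \<and> v < Min ?M) \<and> \<not> (Min ?M < v \<and> v < u)"
      using in_M le_M[of v] u False by auto
  qed (use in_M False in auto)
qed

lemma arc_nearest:
  assumes w: "w \<in> V" "p < w" "w < q" and u: "p \<le> u" "u \<le> q"
  shows "\<exists>r\<in>V. p < r \<and> r < q \<and> (\<exists>R\<subseteq>E. vpt u \<in> cell R \<and> nearest R r)"
proof -
  obtain r where r: "r \<in> V" "p < r" "r < q" "\<And>v. v \<in> V \<Longrightarrow> \<not> (u < v \<and> v < r) \<and> \<not> (r < v \<and> v < u)"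
    using ex_adjacent_vertex[OF assms] by metis
  \<comment> \<open>For chords ending at \<open>u\<close> both sides are possible, and the one that
    does not cut off \<open>r\<close> is chosen.\<close>
  define R where "R = {e \<in> E. 0 \<le> line_form e (vpt u) \<and> \<not> (fst e < r \<and> r < snd e)}"
  have "vpt u \<in> cell R"
    unfolding cell_def
  proof (intro CollectI ballI conjI impI)
    fix e assume e: "e \<in> E" "e \<notin> R"
    show "line_form e (vpt u) \<le> 0"
      using e chord[OF e(1)] r(4)[of "fst e"] r(4)[of "snd e"] line_form_vpt_nonpos[of e u]
      unfolding R_def by auto
  qed (auto simp: R_def)
  moreover have "depth R r = 0"
    unfolding depth_zero_iff
  proof
    fix e assume e: "e \<in> E"
    show "r \<notin> far R e"
      using e chord[OF e] r(4)[of "fst e"] r(4)[of "snd e"] line_form_vpt_nonneg[of e u]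
      unfolding R_def far_def by (auto split: if_splits)
  qed
  moreover have "R \<subseteq> E" unfolding R_def by auto
  ultimately show ?thesis using r(1-3) nearest_depth_zero[OF r(1)] by blast
qed

text \<open>Both vertices lie on the convex cell, so the midpoint of their segment does too, at
  height \<open>(p - q)\<^sup>2 / 4\<close>. This converts coincidences on the boundary into
  interior witnesses.\<close>

lemma witnessed_of_common_zero:
  assumes "p \<in> V" "q \<in> V" "p \<noteq> q" "depth R p = 0" "depth R q = 0"
  shows "witnessed p q"
proof -
  let ?x = "vpt p + (1 / 2) *\<^sub>R (vpt q - vpt p)"
  have "?x \<in> cell R" using assms by (intro cell_conv depth_zero_vpt_cell) auto
  moreover have "(fst ?x)\<^sup>2 < snd ?x"
  proof -
    have "snd ?x - (fst ?x)\<^sup>2 = (1 - 1 / 2) * (snd (vpt p) - (fst (vpt p))\<^sup>2)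
        + 1 / 2 * (1 - 1 / 2) * (fst (vpt p) - q)\<^sup>2" by (rule height_segment)
    also have "\<dots> = (p - q)\<^sup>2 / 4" by (simp add: vpt_def)
    also have "\<dots> > 0" using assms(3) by simp
    finally show ?thesis by linarith
  qed
  ultimately show ?thesis using assms nearest_depth_zero unfolding witnessed_def by blast
qed

lemma witnessed_split:
  assumes w: "witnessed p q" and pq: "p < q" and v: "v \<in> V" "p < v" "v < q"
  shows "\<exists>r\<in>V. p < r \<and> r < q \<and> witnessed p r \<and> witnessed r q"
proof -
  obtain x P Q where x: "(fst x)\<^sup>2 < snd x" and P: "x \<in> cell P" "nearest P p"
    and Q: "x \<in> cell Q" "nearest Q q"
    using w unfolding witnessed_def by blast
  have V: "p \<in> V" "q \<in> V" using P Q unfolding nearest_def by auto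
  define near where "near r = (\<Union>R\<in>{R. R \<subseteq> E \<and> nearest R r}. cell R)" for r
  have nearI: "y \<in> near r" if "y \<in> cell R" "R \<subseteq> E" "nearest R r" for y r R
    using that unfolding near_def by auto
  have nearE: "\<exists>R\<subseteq>E. y \<in> cell R \<and> nearest R r" if "y \<in> near r" for y r
    using that unfolding near_def by auto
  have finR: "finite {R. R \<subseteq> E \<and> nearest R r}" for r
    by (rule finite_subset[of _ "Pow E"]) (use finE in auto)
  have closed_near: "closed (near r)" for r
    unfolding near_def by (intro closed_UN finR closed_cell ballI)
  \<comment> \<open>Points strictly on the side of \<open>vpt r\<close> for all chords not ending at
    \<open>r\<close>. Every cell containing such a point gives \<open>r\<close> depth 0.\<close>
  define star where "star r = {y. \<forall>e\<in>E. fst e \<noteq> r \<longrightarrow> snd e \<noteq> r \<longrightarrow> 0 < line_form e y * line_form e (vpt r)}" for r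
  have open_star: "open (star r)" for r
  proof -
    have "star r = (\<Inter>e\<in>{e \<in> E. fst e \<noteq> r \<and> snd e \<noteq> r}. {y. 0 < line_form e y * line_form e (vpt r)})"
      unfolding star_def by auto
    moreover have "open {y. 0 < line_form e y * line_form e (vpt r)}" for e
      by (intro open_Collect_less continuous_intros continuous_line_form)
    ultimately show ?thesis using finE by (auto intro!: open_INT)
  qed
  have star_near: "y \<in> near r" if "y \<in> star r" "r \<in> V" for y r
  proof -
    obtain R where R: "R \<subseteq> E" "y \<in> cell R" using ex_cell by blast
    have "r \<notin> far R e" if e: "e \<in> E" for e
    proof
      assume f: "r \<in> far R e"
      then have "fst e \<noteq> r" "snd e \<noteq> r" using endpoint_notin_far[OF e] by auto
      then have pos: "0 < line_form e y * line_form e (vpt r)"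
        using \<open>y \<in> star r\<close> e unfolding star_def by auto
      have "line_form e y * line_form e (vpt r) \<le> 0"
      proof (cases "e \<in> R")
        case True
        then have "0 \<le> line_form e y" "line_form e (vpt r) \<le> 0"
          using R e f chord[OF e] line_form_vpt_nonpos[of e r] unfolding cell_def far_def by auto
        then show ?thesis by (rule mult_nonneg_nonpos)
      next
        case False
        then have "line_form e y \<le> 0" "0 \<le> line_form e (vpt r)"
          using R e f chord[OF e] line_form_vpt_nonneg[of e r] unfolding cell_def far_def by auto
        then show ?thesis by (rule mult_nonpos_nonneg)
      qed
      then show False using pos by linarith
    qed
    then have "depth R r = 0" unfolding depth_zero_iff by blast
    then show ?thesis using R nearest_depth_zero[OF \<open>r \<in> V\<close>] by (auto intro: nearI)
  qed
  \<comment> \<open>A neighbourhood of the corner \<open>vpt r\<close> where the label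
    \<open>r'\<close> will be deleted. Inside the star the label \<open>r\<close> takes over; the
    distance condition makes \<open>U p q\<close> and \<open>U q p\<close> disjoint, so that no
    point loses both labels; sparing the segment to \<open>r'\<close> preserves the boundary
    conditions.\<close>
  define U where "U r r' = star r \<inter> {y. dist y (vpt r) < dist y (vpt r')} - closed_segment x (vpt r')" for r r'
  have openU: "open (U r r')" for r r'
    unfolding U_def by (intro open_Diff open_Int open_star open_Collect_less continuous_intros
        closed_segment)
  \<comment> \<open>Polar coordinates around \<open>x\<close>: \<open>s = 0\<close> is
    \<open>x\<close>, \<open>s = 1\<close> the arc, and \<open>u = p\<close>, \<open>u = q\<close>
    are the two bounding segments.\<close>
  define \<Phi> where "\<Phi> z = x + fst z *\<^sub>R (vpt (snd z) - x)" for z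
  define A where "A = near p - U q p"
  define B where "B = near q - U p q"
  define C where "C = (\<Union>r\<in>{r \<in> V. p < r \<and> r < q}. near r)"
  have closed: "closed A" "closed B" "closed C"
    unfolding A_def B_def C_def using finV
    by (auto intro!: closed_Diff closed_near openU closed_UN)
  have segA: "y \<in> A" if "y \<in> closed_segment x (vpt p)" for y
  proof -
    obtain s where "0 \<le> s" "s \<le> 1" "y = x + s *\<^sub>R (vpt p - x)"
      using \<open>y \<in> closed_segment x (vpt p)\<close> by (auto simp: in_segment algebra_simps)
    from segment_nearest[OF P this] have "y \<in> near p" by (auto intro: nearI)
    then show ?thesis using that unfolding A_def U_def by auto
  qed
  have segB: "y \<in> B" if "y \<in> closed_segment x (vpt q)" for y
  proof -
    obtain s where "0 \<le> s" "s \<le> 1" "y = x + s *\<^sub>R (vpt q - x)"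
      using \<open>y \<in> closed_segment x (vpt q)\<close> by (auto simp: in_segment algebra_simps)
    from segment_nearest[OF Q this] have "y \<in> near q" by (auto intro: nearI)
    then show ?thesis using that unfolding B_def U_def by auto
  qed
  have seg: "\<Phi> (s, u) \<in> closed_segment x (vpt u)" if "0 \<le> s" "s \<le> 1" for s u
    using that unfolding \<Phi>_def by (auto simp: in_segment algebra_simps intro!: exI[of _ s])
  have top: "\<Phi> (1, u) \<in> C" if h: "p \<le> u" "u \<le> q" for u
  proof -
    obtain r R where "r \<in> V" "p < r" "r < q" "R \<subseteq> E" "vpt u \<in> cell R" "nearest R r"
      using arc_nearest[OF v h] by blast
    then show ?thesis unfolding C_def \<Phi>_def by (auto intro!: nearI)
  qed
  have bot: "\<Phi> (0, u) \<in> A" "\<Phi> (0, u) \<in> B" for u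
    using segA[of x] segB[of x] unfolding \<Phi>_def by auto
  have cover: "\<Phi> (s, u) \<in> A \<union> B \<union> C" if s: "0 \<le> s" "s \<le> 1" and u: "p \<le> u" "u \<le> q" for s u
  proof -
    define y where "y = \<Phi> (s, u)"
    have near: "y \<in> near p \<union> near q \<union> C"
    proof -
      consider "s = 0" | "u = p" | "u = q" | "0 < s" "p < u" "u < q" using s u by linarith
      then show ?thesis
      proof cases
        case 1 then show ?thesis using bot(1)[of u] unfolding y_def A_def by auto
      next
        case 2 then show ?thesis using segA[OF seg[OF s, of p]] unfolding y_def A_def by auto
      next
        case 3 then show ?thesis using segB[OF seg[OF s, of q]] unfolding y_def B_def by auto
      next
        case 4
        obtain R where R: "R \<subseteq> E" "y \<in> cell R" using ex_cell by blast
        obtain r where r: "nearest R r" using ex_nearest by blast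
        show ?thesis
        proof (cases "p \<le> r \<and> r \<le> q")
          case True
          then consider "r = p" | "r = q" | "p < r" "r < q" by linarith
          then show ?thesis
          proof cases
            case 3
            then show ?thesis using R r unfolding C_def nearest_def by (auto intro!: bexI[of _ r] nearI simp: nearest_def)
          qed (use R r nearI in auto)
        next
          case False
          then have out: "r < p \<or> q < r" by auto
          have rV: "r \<in> V" using r unfolding nearest_def by auto
          have Pr: "depth P p \<le> depth P r" and Qr: "depth Q q \<le> depth Q r"
            using P(2) Q(2) rV unfolding nearest_def by auto
          have yx: "y = x + s *\<^sub>R (vpt u - x)" unfolding y_def \<Phi>_def by simp
          from outside_vertex_not_nearer[OF x P(1) Q(1) R(2) yx 4(1) s(2) 4(2,3) out V rV]
          have "depth R p \<le> depth R r \<or> depth R q \<le> depth R r" using Pr Qr by linarith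
          then have "nearest R p \<or> nearest R q"
            using r V unfolding nearest_def by (meson order_trans)
          then show ?thesis using R nearI by blast
        qed
      qed
    qed
    have "y \<in> near p" if "y \<in> U p q" using star_near[of y p] that V unfolding U_def by auto
    moreover have "y \<in> near q" if "y \<in> U q p" using star_near[of y q] that V unfolding U_def by auto
    moreover have "\<not> (y \<in> U p q \<and> y \<in> U q p)" unfolding U_def by auto
    ultimately show ?thesis using near unfolding y_def[symmetric] A_def B_def by blast
  qed
  have neA: "A \<noteq> {}" "B \<noteq> {}" "C \<noteq> {}" using bot[of p] top[of p] pq by auto
  define a where "a z = infdist (\<Phi> z) A" for z
  define b where "b z = infdist (\<Phi> z) B" for z
  define c where "c z = infdist (\<Phi> z) C" for z
  have cont\<Phi>: "continuous_on S \<Phi>" for S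
    unfolding \<Phi>_def vpt_def by (intro continuous_intros)
  have cont: "continuous_on S a" "continuous_on S b" "continuous_on S c" for S
    unfolding a_def b_def c_def by (intro continuous_on_infdist cont\<Phi>)+
  have nn: "0 \<le> a z" "0 \<le> b z" "0 \<le> c z" for z unfolding a_def b_def c_def by (auto simp: infdist_nonneg)
  \<comment> \<open>A zero is a point with equal distances to \<open>A\<close>, \<open>B\<close> and
    \<open>C\<close>. The signs come from \<open>x\<close> lying in both \<open>A\<close> and
    \<open>B\<close>, the arc in \<open>C\<close>, and the two bounding segments in \<open>A\<close>
    and \<open>B\<close>.\<close>
  have "\<exists>z\<in>{0..1} \<times> {p..q}. min (a z) (b z) - c z = 0 \<and> a z - b z = 0"
  proof (rule poincare_miranda)
    show "continuous_on ({0..1} \<times> {p..q}) (\<lambda>z. min (a z) (b z) - c z)"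
      "continuous_on ({0..1} \<times> {p..q}) (\<lambda>z. a z - b z)"
      by (intro continuous_intros cont)+
    show "min (a (0, u)) (b (0, u)) - c (0, u) \<le> 0 \<and> 0 \<le> min (a (1, u)) (b (1, u)) - c (1, u)"
      if "u \<in> {p..q}" for u
    proof -
      have "a (0, u) = 0" "c (1, u) = 0" using bot(1)[of u] top[of u] that unfolding a_def c_def by auto
      then show ?thesis using nn[of "(0, u)"] nn[of "(1, u)"] by auto
    qed
    show "a (s, p) - b (s, p) \<le> 0 \<and> 0 \<le> a (s, q) - b (s, q)" if "s \<in> {0..1}" for s
    proof -
      have "a (s, p) = 0" "b (s, q) = 0"
        using segA[OF seg[of s p]] segB[OF seg[of s q]] that unfolding a_def b_def by auto
      then show ?thesis using nn[of "(s, p)"] nn[of "(s, q)"] by auto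
    qed
  qed (use pq in auto)
  then obtain s u where su: "0 \<le> s" "s \<le> 1" "p \<le> u" "u \<le> q"
    and eq: "a (s, u) = b (s, u)" "a (s, u) = c (s, u)" by auto
  define y where "y = \<Phi> (s, u)"
  \<comment> \<open>The three sets cover the region, so one distance vanishes, and with it all
    three.\<close>
  have zero: "a (s, u) = 0"
  proof -
    consider "y \<in> A" | "y \<in> B" | "y \<in> C" using cover[OF su] unfolding y_def by auto
    then show ?thesis using eq unfolding a_def b_def c_def y_def by cases auto
  qed
  then have y: "y \<in> A" "y \<in> B" "y \<in> C"
    using eq closed neA in_closed_iff_infdist_zero unfolding a_def b_def c_def y_def by metis+
  obtain R1 where R1: "y \<in> cell R1" "nearest R1 p" using y(1) nearE unfolding A_def by blast
  obtain R2 where R2: "y \<in> cell R2" "nearest R2 q" using y(2) nearE unfolding B_def by blast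
  have height: "snd y - (fst y)\<^sup>2 = (1 - s) * (snd x - (fst x)\<^sup>2) + s * (1 - s) * (fst x - u)\<^sup>2"
    unfolding y_def \<Phi>_def fst_conv snd_conv by (rule height_segment)
  show ?thesis
  proof (cases "s < 1")
    case True
    then have "0 < (1 - s) * (snd x - (fst x)\<^sup>2)" using x by simp
    moreover have "0 \<le> s * (1 - s) * (fst x - u)\<^sup>2" using su by simp
    ultimately have hy: "(fst y)\<^sup>2 < snd y" using height by linarith
    obtain r where r: "r \<in> V" "p < r" "r < q" "y \<in> near r" using y(3) unfolding C_def by auto
    then obtain R3 where "y \<in> cell R3" "nearest R3 r" using nearE by blast
    then show ?thesis using r hy R1 R2 unfolding witnessed_def by blast
  next
    case False
    then have yu: "y = vpt u" using su unfolding y_def \<Phi>_def by auto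
    \<comment> \<open>The trimming pays off here: \<open>vpt p\<close> is not in \<open>B\<close>
      and \<open>vpt q\<close> is not in \<open>A\<close>, so a solution on the parabola lies in the
      open arc.\<close>
    have corner: "vpt r \<in> U r r'" if r: "r \<in> V" "r \<noteq> r'" for r r'
    proof -
      have "vpt r \<in> star r"
        unfolding star_def
      proof (intro CollectI ballI impI)
        fix e assume "fst e \<noteq> r" "snd e \<noteq> r"
        then have "line_form e (vpt r) \<noteq> 0" by (simp add: line_form_vpt)
        then show "0 < line_form e (vpt r) * line_form e (vpt r)" using not_real_square_gt_zero by blast
      qed
      moreover have "dist (vpt r) (vpt r) < dist (vpt r) (vpt r')" using r by (auto simp: vpt_def)
      moreover have "vpt r \<notin> closed_segment x (vpt r')"
      proof
        assume "vpt r \<in> closed_segment x (vpt r')"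
        then obtain \<sigma> where \<sigma>: "0 \<le> \<sigma>" "\<sigma> \<le> 1" "vpt r = x + \<sigma> *\<^sub>R (vpt r' - x)"
          by (auto simp: in_segment algebra_simps)
        have "0 = (1 - \<sigma>) * (snd x - (fst x)\<^sup>2) + \<sigma> * (1 - \<sigma>) * (fst x - r')\<^sup>2"
          using height_segment[of x \<sigma> r'] unfolding \<sigma>(3)[symmetric] by (simp add: vpt_def)
        moreover have "0 \<le> \<sigma> * (1 - \<sigma>) * (fst x - r')\<^sup>2" using \<sigma> by simp
        moreover have "0 < (1 - \<sigma>) * (snd x - (fst x)\<^sup>2)" if "\<sigma> < 1" using x that by simp
        ultimately have "\<sigma> = 1" using \<sigma>(2) by (metis add_pos_nonneg order_le_less less_irrefl)
        then show False using \<sigma>(3) r(2) by (auto simp: vpt_def)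
      qed
      ultimately show ?thesis unfolding U_def by auto
    qed
    have "u \<noteq> p" using corner[OF V(1), of q] pq y(2) yu unfolding B_def by auto
    moreover have "u \<noteq> q" using corner[OF V(2), of p] pq y(1) yu unfolding A_def by auto
    ultimately have u: "p < u" "u < q" using su by auto
    obtain r where r: "r \<in> V" "p < r" "r < q"
      "\<And>v. v \<in> V \<Longrightarrow> \<not> (u < v \<and> v < r) \<and> \<not> (r < v \<and> v < u)" "u \<in> V \<Longrightarrow> r = u"
      using ex_adjacent_vertex[OF v su(3,4)] u by metis
    \<comment> \<open>No chord end lies strictly between \<open>u\<close> and \<open>r\<close>, so
      every cell at \<open>vpt u\<close> gives \<open>r\<close> depth 0. The nearest vertices
      \<open>p\<close> and \<open>q\<close> then have depth 0 as well.\<close>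
    have zero: "depth R r = 0" if R: "vpt u \<in> cell R" for R
      unfolding depth_zero_iff
    proof
      fix e assume e: "e \<in> E"
      have "e \<in> R \<Longrightarrow> u \<le> fst e \<or> snd e \<le> u" "e \<notin> R \<Longrightarrow> fst e \<le> u \<and> u \<le> snd e"
        using R e chord[OF e] line_form_vpt_nonneg[of e u] line_form_vpt_nonpos[of e u]
        unfolding cell_def by auto
      then show "r \<notin> far R e"
        using chord[OF e] r(4)[of "fst e"] r(4)[of "snd e"] r(5)
        unfolding far_def by (auto split: if_splits)
    qed
    have z1: "depth R1 r = 0" and z2: "depth R2 r = 0" using zero R1(1) R2(1) yu by auto
    then have "depth R1 p = 0" "depth R2 q = 0"
      using R1(2) R2(2) r(1) unfolding nearest_def by fastforce+
    then have "witnessed p r" "witnessed r q"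
      using z1 z2 r V witnessed_of_common_zero[of p r R1] witnessed_of_common_zero[of r q R2] by auto
    then show ?thesis using r by blast
  qed
qed

section \<open>The outer diagonal and the triangulation\<close>

lemma witnessed_Min_Max: "witnessed (Min V) (Max V)"
proof -
  \<comment> \<open>At abscissa 0 the form of \<open>e\<close> is \<open>Y + fst e * snd e\<close>,
    so this point is above all chords, in a cell where the two extreme vertices have depth
    0.\<close>
  define Y where "Y = 1 + (\<Sum>e\<in>E. \<bar>fst e * snd e\<bar>)"
  have Y: "0 < Y" unfolding Y_def by (simp add: add_pos_nonneg sum_nonneg)
  have "0 \<le> line_form e (0, Y)" if "e \<in> E" for e
  proof -
    have "\<bar>fst e * snd e\<bar> \<le> (\<Sum>e\<in>E. \<bar>fst e * snd e\<bar>)" using finE that by (intro member_le_sum) auto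
    then show ?thesis unfolding line_form_def Y_def by simp
  qed
  then have "(0, Y) \<in> cell E" unfolding cell_def by auto
  moreover have "depth E (Min V) = 0" "depth E (Max V) = 0"
  proof -
    have "Min V \<notin> far E e \<and> Max V \<notin> far E e" if "e \<in> E" for e
      using that chord[OF that] Min_le[OF finV, of "fst e"] Max_ge[OF finV, of "snd e"]
      unfolding far_def by (auto simp del: Min_le Max_ge)
    then show "depth E (Min V) = 0" "depth E (Max V) = 0" unfolding depth_zero_iff by blast+
  qed
  ultimately show ?thesis unfolding witnessed_def
    using Y nearest_depth_zero Min_in[OF finV neV] Max_in[OF finV neV]
    by (intro exI[of _ "(0, Y)"]) auto
qed

lemma witnessed_triangulated:
  assumes "p \<in> V" "q \<in> V" "p < q" "witnessed p q"
  shows "triangulated V witnessed p q"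
  using assms
proof (induction "card {v \<in> V. p < v \<and> v < q}" arbitrary: p q rule: less_induct)
  case less
  show ?case
  proof (cases "\<exists>v\<in>V. p < v \<and> v < q")
    case True
    then obtain r where r: "r \<in> V" "p < r" "r < q" "witnessed p r" "witnessed r q"
      using witnessed_split[OF less.prems(4,3)] by blast
    have "card {v \<in> V. p < v \<and> v < r} < card {v \<in> V. p < v \<and> v < q}"
      "card {v \<in> V. r < v \<and> v < q} < card {v \<in> V. p < v \<and> v < q}"
      by (rule psubset_card_mono; use finV r in auto)+
    then have "triangulated V witnessed p r" "triangulated V witnessed r q"
      using less.hyps less.prems r by auto
    then show ?thesis using less.prems by (auto intro: triangulated.split)
  next
    case False
    then show ?thesis using less.prems by (auto intro: triangulated.edge)
  qed
qed

end

section \<open>Points in general position\<close>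

definition concurrency_free :: "real set \<Rightarrow> bool" where
  "concurrency_free S \<longleftrightarrow> (\<forall>x. (fst x)\<^sup>2 < snd x \<longrightarrow>
     card {e. fst e \<in> S \<and> snd e \<in> S \<and> fst e < snd e \<and> line_form e x = 0} \<le> 2)"

lemma concurrent_distinct_ends:
  assumes x: "(fst x)\<^sup>2 < snd x" and e: "line_form e x = 0" "fst e < snd e"
    and f: "line_form f x = 0" "fst f < snd f" and "snd e = snd f"
  shows "e = f"
proof -
  have "fst x < snd e" using below_line_imp_between[OF x] e by auto
  moreover have "(fst x - fst e) * (fst x - snd e) = (fst x - fst f) * (fst x - snd e)"
    using line_form_height[of e x] line_form_height[of f x] e(1) f(1) unfolding assms(6) by linarith
  ultimately have "fst e = fst f" by simp
  then show ?thesis using assms(6) by (simp add: prod_eq_iff)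
qed

text \<open>\<open>(X, Y)\<close> is the common point of the lines \<open>e\<close> and
  \<open>f\<close>; the value is the other end of the chord from \<open>a\<close> through it. Where
  this is applied, the denominators are nonzero.\<close>

definition third_end :: "real \<Rightarrow> real \<times> real \<Rightarrow> real \<times> real \<Rightarrow> real" where
  "third_end a e f =
     (let X = (fst e * snd e - fst f * snd f) / (fst e + snd e - fst f - snd f);
          Y = (fst e + snd e) * X - fst e * snd e
      in (a * X - Y) / (a - X))"

lemma concurrent_third_end:
  assumes x: "(fst x)\<^sup>2 < snd x" and e: "line_form e x = 0" "fst e < snd e"
    and f: "line_form f x = 0" "fst f < snd f" and ef: "e \<noteq> f"
    and g: "line_form g x = 0" "fst g < snd g"
  shows "snd g = third_end (fst g) e f"
proof -
  obtain X Y where xy: "x = (X, Y)" by (cases x)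
  obtain a b where eab: "e = (a, b)" by (cases e)
  obtain c d where fcd: "f = (c, d)" by (cases f)
  obtain p q where gpq: "g = (p, q)" by (cases g)
  have 1: "Y = (a + b) * X - a * b" and 2: "Y = (c + d) * X - c * d" and 3: "Y = (p + q) * X - p * q"
    using e f g unfolding line_form_def xy eab fcd gpq by auto
  have eq: "(a + b - c - d) * X = a * b - c * d" using 1 2 by (simp add: algebra_simps)
  \<comment> \<open>Parallel lines with a common point would have equal sums and products of their
    ends, hence equal ends.\<close>
  have ne: "a + b - c - d \<noteq> 0"
  proof
    assume z: "a + b - c - d = 0"
    then have ab: "a * b = c * d" using eq by simp
    have "(a - c) * (a - d) = a * a - a * (c + d) + c * d" by (simp add: algebra_simps)
    also have "\<dots> = a * a - a * (a + b) + a * b" using z ab by simp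
    also have "\<dots> = 0" by (simp add: algebra_simps)
    finally have "a = c \<or> a = d" by simp
    then show False using z ef e f unfolding eab fcd by auto
  qed
  have X: "X = (a * b - c * d) / (a + b - c - d)" using eq ne by (simp add: field_simps)
  have "p < X" using below_line_imp_between[OF x _ g(2)] g(1) unfolding xy gpq by auto
  then have "q = (p * X - Y) / (p - X)" using 3 by (simp add: field_simps)
  then show ?thesis
    unfolding third_end_def Let_def eab fcd gpq fst_conv snd_conv X[symmetric] 1[symmetric] .
qed

text \<open>Points are placed in increasing order, each to the right of the finitely many positions
  where a chord from it would pass through the common point of two earlier chords.\<close>

lemma ex_concurrency_free_positions:
  assumes "finite W"
  shows "\<exists>\<phi> :: real \<Rightarrow> real. strict_mono_on W \<phi> \<and> concurrency_free (\<phi> ` W)"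
  using assms
proof (induction rule: finite_linorder_max_induct)
  case empty
  then show ?case by (auto simp: concurrency_free_def strict_mono_on_def)
next
  case (insert b A)
  then obtain \<phi> where \<phi>: "strict_mono_on A \<phi>" "concurrency_free (\<phi> ` A)" by auto
  define S where "S = \<phi> ` A"
  have finS: "finite S" unfolding S_def using insert by auto
  define bad where "bad = (\<lambda>(a, e, f). third_end a e f) ` (S \<times> (S \<times> S) \<times> (S \<times> S))"
  have "finite bad" unfolding bad_def using finS by auto
  then have finbS: "finite (bad \<union> S)" using finS by auto
  obtain w where w: "\<And>y. y \<in> bad \<union> S \<Longrightarrow> y < w"
  proof (rule that[of "1 + Max (insert 0 (bad \<union> S))"])
    fix y assume "y \<in> bad \<union> S"
    then have "y \<le> Max (insert 0 (bad \<union> S))" using finbS by (intro Max_ge) auto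
    then show "y < 1 + Max (insert 0 (bad \<union> S))" by linarith
  qed
  define \<psi> where "\<psi> = \<phi>(b := w)"
  have bA: "b \<notin> A" using insert by auto
  have img: "\<psi> ` insert b A = insert w S" unfolding \<psi>_def S_def using bA by auto
  have "strict_mono_on (insert b A) \<psi>"
    unfolding strict_mono_on_def
  proof (intro allI impI)
    fix r s assume rs: "r \<in> insert b A \<and> s \<in> insert b A \<and> r < s"
    then have "r \<in> A" using insert.hyps(2) by auto
    show "\<psi> r < \<psi> s"
    proof (cases "s = b")
      case True
      then show ?thesis using \<open>r \<in> A\<close> bA w[of "\<phi> r"] unfolding \<psi>_def S_def by auto
    next
      case False
      then show ?thesis using rs \<open>r \<in> A\<close> bA \<phi>(1) unfolding \<psi>_def strict_mono_on_def by auto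
    qed
  qed
  moreover have "concurrency_free (insert w S)"
    unfolding concurrency_free_def
  proof (intro allI impI)
    fix x :: "real \<times> real" assume x: "(fst x)\<^sup>2 < snd x"
    define C where "C S = {e. fst e \<in> S \<and> snd e \<in> S \<and> fst e < snd e \<and> line_form e x = 0}" for S
    have finC: "finite (C S)" if "finite S" for S
      by (rule finite_subset[of _ "S \<times> S"]) (use that in \<open>auto simp: C_def mem_Times_iff\<close>)
    have cS: "card (C S) \<le> 2" using \<phi>(2) x unfolding S_def[symmetric] concurrency_free_def C_def by blast
    \<comment> \<open>At most one chord through \<open>x\<close> ends at the new point
      \<open>w\<close>, and if one does, the choice of \<open>w\<close> leaves room for at most one
      old chord.\<close>
    show "card {e. fst e \<in> insert w S \<and> snd e \<in> insert w S \<and> fst e < snd e \<and> line_form e x = 0} \<le> 2"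
    proof (cases "\<exists>g\<in>C (insert w S). snd g = w")
      case True
      then obtain g where g: "g \<in> C (insert w S)" "snd g = w" by auto
      have sub: "C (insert w S) \<subseteq> insert g (C S)"
      proof
        fix e assume e: "e \<in> C (insert w S)"
        show "e \<in> insert g (C S)"
        proof (cases "snd e = w")
          case True
          then have "e = g" using concurrent_distinct_ends[OF x, of e g] e g unfolding C_def by auto
          then show ?thesis by simp
        next
          case False
          then have "fst e \<noteq> w" using e w unfolding C_def by fastforce
          then show ?thesis using e False unfolding C_def by auto
        qed
      qed
      have "card (C S) \<le> 1"
      proof (rule ccontr)
        assume "\<not> card (C S) \<le> 1"
        then obtain e f where ef: "e \<in> C S" "f \<in> C S" "e \<noteq> f"
          using card_le_Suc0_iff_eq[OF finC[OF finS]] by auto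
        then have "w = third_end (fst g) e f"
          using concurrent_third_end[OF x, of e f g] g unfolding C_def by auto
        moreover have "fst g \<in> S" using g unfolding C_def by auto
        ultimately have "w \<in> bad" using ef unfolding bad_def C_def
          by (intro image_eqI[of _ _ "(fst g, e, f)"]) (auto simp: mem_Times_iff)
        then show False using w by fastforce
      qed
      then have "card (insert g (C S)) \<le> 2" using card_insert_le_m1[of 2 "C S" g] by simp
      then have "card (C (insert w S)) \<le> 2"
        using card_mono[OF _ sub] finC[OF finS] by (meson finite.insertI order_trans)
      then show ?thesis unfolding C_def by simp
    next
      case False
      have "C (insert w S) \<subseteq> C S"
      proof
        fix e assume e: "e \<in> C (insert w S)"
        then have "snd e \<noteq> w" using False by auto
        moreover have "fst e \<noteq> w" using e w unfolding C_def by fastforce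
        ultimately show "e \<in> C S" using e unfolding C_def by auto
      qed
      then have "card (C (insert w S)) \<le> 2" using cS card_mono[OF finC[OF finS]] by (meson order_trans)
      then show ?thesis unfolding C_def by simp
    qed
  qed
  ultimately show ?case using img by (intro exI[of _ \<psi>]) auto
qed

section \<open>Circular drawings\<close>

text \<open>Twice the signed area of the triangle \<open>pqr\<close>, positive for counterclockwise
  order.\<close>

definition orient :: "complex \<Rightarrow> complex \<Rightarrow> complex \<Rightarrow> real" where
  "orient p q r = (Re q - Re p) * (Im r - Im p) - (Im q - Im p) * (Re r - Re p)"

lemma segments_meet:
  assumes pos: "0 < orient b c d" "0 < orient a c d" "0 < orient a b d" "0 < orient a b c"
    and ne: "a \<noteq> c" "b \<noteq> d"
  shows "\<exists>z. z \<in> closed_segment a c \<and> z \<in> closed_segment b d \<and> z \<notin> {a, c, b, d}"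
proof -
  \<comment> \<open>Twice the area of the quadrilateral \<open>abcd\<close>, split along either
    diagonal. The diagonals divide each other in the ratio of these partial areas.\<close>
  define s where "s = orient b c d + orient a b d"
  have s: "0 < s" "s = orient a c d + orient a b c"
    using pos unfolding s_def orient_def by (auto simp: algebra_simps)
  define u where "u = orient a b d / s"
  define v where "v = orient a b c / s"
  have u: "0 < u" "u < 1" and v: "0 < v" "v < 1"
    unfolding u_def v_def using pos s s_def by (auto simp: field_simps)
  define z where "z = (1 - u) *\<^sub>R a + u *\<^sub>R c"
  have "s *\<^sub>R ((1 - u) *\<^sub>R a + u *\<^sub>R c) = s *\<^sub>R ((1 - v) *\<^sub>R b + v *\<^sub>R d)"
  proof -
    have m: "s * (1 - u) = orient b c d" "s * u = orient a b d" "s * (1 - v) = orient a c d" "s * v = orient a b c"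
    proof -
      have "s * u = orient a b d" "s * v = orient a b c" unfolding u_def v_def using s(1) by auto
      then show "s * (1 - u) = orient b c d" "s * u = orient a b d"
        "s * (1 - v) = orient a c d" "s * v = orient a b c"
        using s(2) s_def unfolding right_diff_distrib by linarith+
    qed
    show ?thesis
      unfolding scaleR_add_right scaleR_scaleR m
      by (auto simp: complex_eq_iff orient_def algebra_simps)
  qed
  then have z2: "z = (1 - v) *\<^sub>R b + v *\<^sub>R d" using s(1) unfolding z_def by simp
  have 1: "z - a = u *\<^sub>R (c - a)" "z - c = (1 - u) *\<^sub>R (a - c)" unfolding z_def by (auto simp: algebra_simps)
  have 2: "z - b = v *\<^sub>R (d - b)" "z - d = (1 - v) *\<^sub>R (b - d)" unfolding z2 by (auto simp: algebra_simps)
  have "z \<noteq> a" "z \<noteq> c" "z \<noteq> b" "z \<noteq> d" using 1 2 u v ne by auto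
  moreover have "z \<in> closed_segment a c" unfolding z_def in_segment using u by (intro exI[of _ u]) auto
  moreover have "z \<in> closed_segment b d" unfolding z2 in_segment using v by (intro exI[of _ v]) auto
  ultimately show ?thesis by blast
qed

text \<open>The area factors into sines of half the angle differences, all of which lie strictly
  between 0 and \<open>pi\<close>.\<close>

lemma orient_circle_pos:
  assumes r: "0 < r" and ang: "\<alpha> < \<beta>" "\<beta> < \<gamma>" "\<gamma> < \<alpha> + 2 * pi"
  shows "0 < orient (c + of_real r * cis \<alpha>) (c + of_real r * cis \<beta>) (c + of_real r * cis \<gamma>)"
proof -
  define x where "x = (\<beta> - \<alpha>) / 2"
  define y where "y = (\<gamma> - \<beta>) / 2"
  have s: "0 < sin x" "0 < sin y" "0 < sin (x + y)"
    unfolding x_def y_def using ang by (auto intro!: sin_gt_zero simp: field_simps)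
  have "orient (c + of_real r * cis \<alpha>) (c + of_real r * cis \<beta>) (c + of_real r * cis \<gamma>)
      = r\<^sup>2 * (sin (\<beta> - \<alpha>) + sin (\<gamma> - \<beta>) - sin (\<gamma> - \<alpha>))"
    unfolding orient_def sin_diff by (simp add: algebra_simps power2_eq_square)
  also have "sin (\<beta> - \<alpha>) + sin (\<gamma> - \<beta>) - sin (\<gamma> - \<alpha>) = 4 * sin x * sin y * sin (x + y)"
  proof -
    have "\<beta> - \<alpha> = 2 * x" "\<gamma> - \<beta> = 2 * y" "\<gamma> - \<alpha> = 2 * x + 2 * y"
      unfolding x_def y_def by (auto simp: field_simps)
    moreover have "sin (2 * x) + sin (2 * y) - sin (2 * x + 2 * y) = 4 * sin x * sin y * sin (x + y)"
      unfolding sin_add sin_double cos_double_sin by (simp add: algebra_simps power2_eq_square)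
    ultimately show ?thesis by metis
  qed
  also have "r\<^sup>2 * (4 * sin x * sin y * sin (x + y)) > 0" using r s by simp
  finally show ?thesis .
qed

text \<open>The angles around the centre order the vertices. One implication is enough, since a
  minor survives in a graph with more edges.\<close>

lemma circular_drawing_order:
  assumes "circular_drawing G D"
  obtains \<alpha> :: "'a \<Rightarrow> real" where "inj_on \<alpha> (verts G)"
    "\<forall>a b c d. {a, b, c, d} \<subseteq> verts G \<longrightarrow> \<alpha> a < \<alpha> c \<longrightarrow> \<alpha> c < \<alpha> b \<longrightarrow> \<alpha> b < \<alpha> d \<longrightarrow>
      edges_cross D {a, b} {c, d}"
proof -
  obtain o' r where inj: "inj_on D (verts G)" and r: "0 < r" and sph: "D ` verts G \<subseteq> sphere o' r"
    using assms unfolding circular_drawing_def by blast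
  define \<alpha> where "\<alpha> v = Arg2pi (D v - o')" for v
  have D: "D v = o' + of_real r * cis (\<alpha> v)" if "v \<in> verts G" for v
  proof -
    have "norm (D v - o') = r" using sph that by (auto simp: dist_norm norm_minus_commute)
    then show ?thesis
      using Arg2pi_eq[of "D v - o'"] unfolding \<alpha>_def cis_conv_exp by (simp add: algebra_simps)
  qed
  have range: "0 \<le> \<alpha> v" "\<alpha> v < 2 * pi" for v
    unfolding \<alpha>_def using Arg2pi_ge_0 Arg2pi_lt_2pi by auto
  show thesis
  proof
    show "inj_on \<alpha> (verts G)"
      using inj D unfolding inj_on_def by metis
  next
    have "edges_cross D {a, b} {c, d}" if V: "{a, b, c, d} \<subseteq> verts G" and lt: "\<alpha> a < \<alpha> c" "\<alpha> c < \<alpha> b" "\<alpha> b < \<alpha> d" for a b c d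
    proof -
      have o: "0 < orient (D u) (D v) (D w)"
        if "\<alpha> u < \<alpha> v" "\<alpha> v < \<alpha> w" "u \<in> verts G" "v \<in> verts G" "w \<in> verts G" for u v w
      proof -
        have "\<alpha> w < \<alpha> u + 2 * pi" using range[of u] range[of w] by linarith
        from orient_circle_pos[OF r that(1,2) this] show ?thesis
          using D[OF that(3)] D[OF that(4)] D[OF that(5)] by simp
      qed
      have "a \<noteq> b" "c \<noteq> d" using lt by auto
      then have "D a \<noteq> D b" "D c \<noteq> D d" using inj V unfolding inj_on_def by auto
      then have "\<exists>z. z \<in> closed_segment (D a) (D b) \<and> z \<in> closed_segment (D c) (D d) \<and> z \<notin> {D a, D b, D c, D d}"
        by (intro segments_meet o) (use lt V in auto)
      moreover have "{a, b} \<noteq> {c, d}" using lt by (auto simp: doubleton_eq_iff)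
      ultimately show ?thesis unfolding edges_cross_def by blast
    qed
    then show "\<forall>a b c d. {a, b, c, d} \<subseteq> verts G \<longrightarrow> \<alpha> a < \<alpha> c \<longrightarrow> \<alpha> c < \<alpha> b \<longrightarrow> \<alpha> b < \<alpha> d \<longrightarrow>
      edges_cross D {a, b} {c, d}" by blast
  qed
qed

lemma has_minor_hom:
  assumes inj: "inj_on h (verts X)" and ver: "h ` verts X \<subseteq> verts Y"
    and edg: "\<And>u v. u \<in> verts X \<Longrightarrow> v \<in> verts X \<Longrightarrow> {u, v} \<in> edges X \<Longrightarrow> {h u, h v} \<in> edges Y"
    and "has_minor X H"
  shows "has_minor Y H"
proof -
  obtain M where M: "\<forall>x\<in>verts H. connected_in X (M x)"
    "\<forall>x\<in>verts H. \<forall>y\<in>verts H. x \<noteq> y \<longrightarrow> M x \<inter> M y = {}"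
    "\<forall>x\<in>verts H. \<forall>y\<in>verts H. {x, y} \<in> edges H \<longrightarrow> (\<exists>u\<in>M x. \<exists>v\<in>M y. {u, v} \<in> edges X)"
    using assms(4) unfolding has_minor_def by blast
  have sub: "M x \<subseteq> verts X" if "x \<in> verts H" for x using M(1) that unfolding connected_in_def by auto
  have conn: "connected_in Y (h ` S)" if S: "connected_in X S" for S
  proof -
    have SV: "S \<subseteq> verts X" "S \<noteq> {}" using S unfolding connected_in_def by auto
    let ?R = "{(x, y). x \<in> S \<and> y \<in> S \<and> {x, y} \<in> edges X}"
    let ?Q = "{(x, y). x \<in> h ` S \<and> y \<in> h ` S \<and> {x, y} \<in> edges Y}"
    have "(h u, h v) \<in> ?Q\<^sup>*" if "(u, v) \<in> ?R\<^sup>*" for u v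
      using that
    proof (induction rule: rtrancl_induct)
      case (step y z)
      then have "(h y, h z) \<in> ?Q" using edg SV by auto
      then show ?case using step.IH by (rule rtrancl.rtrancl_into_rtrancl[rotated])
    qed simp
    then show ?thesis using S SV ver unfolding connected_in_def by blast
  qed
  show ?thesis
    unfolding has_minor_def
  proof (intro exI[of _ "\<lambda>x. h ` M x"] conjI ballI impI)
    fix x y assume xy: "x \<in> verts H" "y \<in> verts H"
    show "h ` M x \<inter> h ` M y = {}" if "x \<noteq> y"
      using M(2) xy that inj_on_image_Int[OF inj sub[OF xy(1)] sub[OF xy(2)]] by auto
    show "\<exists>u\<in>h ` M x. \<exists>v\<in>h ` M y. {u, v} \<in> edges Y" if h: "{x, y} \<in> edges H"
    proof -
      obtain u v where "u \<in> M x" "v \<in> M y" "{u, v} \<in> edges X" using M(3) xy h by blast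
      moreover from this have "{h u, h v} \<in> edges Y" using edg sub xy by blast
      ultimately show ?thesis by blast
    qed
  qed (use M conn in auto)
qed

section \<open>Assembling the theorem\<close>

lemma triangulated_ends: "triangulated V T p q \<Longrightarrow> p \<in> V \<and> q \<in> V \<and> p < q \<and> T p q"
  by (induction rule: triangulated.induct) auto

theorem theorem3:
  fixes G :: "'a ugraph" and t :: nat
  assumes "t \<ge> 3"
    and "finite_simple_graph G"
    and "\<exists>D. circular_drawing G D \<and> \<not> has_minor (crossing_graph G D) (complete_graph t)"
  shows "treewidth G \<le> 12 * int t - 23"
proof (cases "verts G = {}")
  case True
  then have "edges G = {}"
    using assms(2) unfolding finite_simple_graph_def by fastforce
  with True have "tree_decomposition G \<lparr>verts = {0 :: nat}, edges = {}\<rparr> (\<lambda>_. {})"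
    unfolding tree_decomposition_def using is_tree_singleton by auto
  then have "treewidth G \<le> int 0 - 1" by (rule treewidth_le) simp
  then show ?thesis using assms(1) by simp
next
  case False
  obtain D where D: "circular_drawing G D" and no_minor: "\<not> has_minor (crossing_graph G D) (complete_graph t)"
    using assms(3) by blast
  obtain \<alpha> :: "'a \<Rightarrow> real" where \<alpha>: "inj_on \<alpha> (verts G)"
    and cross: "\<forall>a b c d. {a, b, c, d} \<subseteq> verts G \<longrightarrow> \<alpha> a < \<alpha> c \<longrightarrow> \<alpha> c < \<alpha> b \<longrightarrow> \<alpha> b < \<alpha> d \<longrightarrow>
      edges_cross D {a, b} {c, d}"
    by (rule circular_drawing_order[OF D]) blast
  have finG: "finite (verts G)" and edge: "\<And>e. e \<in> edges G \<Longrightarrow> e \<subseteq> verts G \<and> card e = 2"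
    using assms(2) unfolding finite_simple_graph_def by auto
  obtain \<phi> where \<phi>: "strict_mono_on (\<alpha> ` verts G) \<phi>" "concurrency_free (\<phi> ` \<alpha> ` verts G)"
    using ex_concurrency_free_positions[of "\<alpha> ` verts G"] finG by auto
  \<comment> \<open>\<open>\<beta>\<close> keeps the cyclic order of the drawing but puts the
    vertices in general position.\<close>
  define \<beta> where "\<beta> v = \<phi> (\<alpha> v)" for v
  define V where "V = \<beta> ` verts G"
  define E where "E = {(\<beta> a, \<beta> b) | a b. {a, b} \<in> edges G \<and> \<beta> a < \<beta> b}"
  define g where "g = inv_into (verts G) \<beta>"
  have less: "\<beta> a < \<beta> b \<longleftrightarrow> \<alpha> a < \<alpha> b" if "a \<in> verts G" "b \<in> verts G" for a b
    unfolding \<beta>_def using \<phi>(1) that by (auto simp: strict_mono_on_less)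
  have inj: "inj_on \<beta> (verts G)"
    using \<alpha> \<phi>(1) unfolding \<beta>_def inj_on_def by (metis imageI strict_mono_on_eqD)
  have g: "g (\<beta> v) = v" if "v \<in> verts G" for v
    unfolding g_def using inj that by simp
  have edgeV: "a \<in> verts G \<and> b \<in> verts G" if "{a, b} \<in> edges G" for a b
    using edge[OF that] by auto
  have EV: "\<exists>a b. e = (\<beta> a, \<beta> b) \<and> {a, b} \<in> edges G \<and> \<beta> a < \<beta> b \<and> a \<in> verts G \<and> b \<in> verts G"
    if "e \<in> E" for e using that edgeV unfolding E_def by auto
  have EI: "(\<beta> a, \<beta> b) \<in> E" if "{a, b} \<in> edges G" "\<beta> a < \<beta> b" for a b
    using that unfolding E_def by blast
  interpret chords V E
  proof
    show "finite V" "V \<noteq> {}" unfolding V_def using finG False by auto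
    show "fst e \<in> V \<and> snd e \<in> V \<and> fst e < snd e" if "e \<in> E" for e
      using EV[OF that] unfolding V_def by auto
  qed
  define h where "h e = {g (fst e), g (snd e)}" for e
  have "\<not> has_minor (chord_graph E) (complete_graph t)"
  proof
    assume "has_minor (chord_graph E) (complete_graph t)"
    then have "has_minor (crossing_graph G D) (complete_graph t)"
    proof (rule has_minor_hom[rotated 3])
      show "inj_on h (verts (chord_graph E))"
        unfolding chord_graph_simps
      proof (rule inj_onI)
        fix e f assume ef: "e \<in> E" "f \<in> E" "h e = h f"
        obtain a b where e: "e = (\<beta> a, \<beta> b)" "\<beta> a < \<beta> b" "a \<in> verts G" "b \<in> verts G" using EV[OF ef(1)] by blast
        obtain c d where f: "f = (\<beta> c, \<beta> d)" "\<beta> c < \<beta> d" "c \<in> verts G" "d \<in> verts G" using EV[OF ef(2)] by blast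
        have "{a, b} = {c, d}" using ef(3) e f g unfolding h_def by auto
        then show "e = f" using e f by (auto simp: doubleton_eq_iff)
      qed
      show "h ` verts (chord_graph E) \<subseteq> verts (crossing_graph G D)"
        unfolding chord_graph_simps crossing_graph_def h_def
        using EV g by fastforce
      fix e f assume "{e, f} \<in> edges (chord_graph E)"
      then have ef: "e \<in> E" "f \<in> E" "crosses e f" unfolding chord_graph_simps by auto
      obtain a b where e: "e = (\<beta> a, \<beta> b)" "{a, b} \<in> edges G" "a \<in> verts G" "b \<in> verts G" using EV[OF ef(1)] by blast
      obtain c d where f: "f = (\<beta> c, \<beta> d)" "{c, d} \<in> edges G" "c \<in> verts G" "d \<in> verts G" using EV[OF ef(2)] by blast
      have "edges_cross D {a, b} {c, d} \<or> edges_cross D {c, d} {a, b}"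
        using ef(3) cross[rule_format, of a b c d] cross[rule_format, of c d a b] less e f unfolding crosses_def by auto
      moreover have "h e = {a, b}" "h f = {c, d}" unfolding h_def using e f g by auto
      ultimately show "{h e, h f} \<in> edges (crossing_graph G D)"
        unfolding crossing_graph_def using e f by (auto simp: doubleton_eq_iff)
    qed
    then show False using no_minor by simp
  qed
  note thin = witnessed_thin[OF assms(1) this]
  have generic: "card {e \<in> E. line_form e x = 0} \<le> 2" if x: "(fst x)\<^sup>2 < snd x" for x
  proof -
    let ?C = "{e. fst e \<in> V \<and> snd e \<in> V \<and> fst e < snd e \<and> line_form e x = 0}"
    have "finite ?C" by (rule finite_subset[of _ "V \<times> V"]) (use finV in \<open>auto simp: mem_Times_iff\<close>)
    moreover have "{e \<in> E. line_form e x = 0} \<subseteq> ?C" using chord by auto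
    moreover have "card ?C \<le> 2"
      using \<phi>(2) x unfolding concurrency_free_def V_def \<beta>_def image_image by blast
    ultimately show ?thesis using card_mono order_trans by meson
  qed
  \<comment> \<open>One end of each of the at most \<open>4 * t - 10\<close> edges crossing a
    diagonal, plus the ends of the diagonal.\<close>
  define k where "k = 4 * t - 8"
  have k: "k \<ge> 1" using assms(1) unfolding k_def by simp
  \<comment> \<open>Half-open, so that the arcs of \<open>pr\<close> and \<open>rq\<close> partition
    that of \<open>pq\<close> and a side of the polygon gives a single vertex.\<close>
  define I where "I p q = {v \<in> verts G. p \<le> \<beta> v \<and> \<beta> v < q}" for p q
  have cover: "\<exists>S. cut_cover G (I p q) S \<and> card S \<le> k" if w: "witnessed p q" and pq: "p < q" "p \<in> V" "q \<in> V" for p q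
  proof -
    let ?S = "{e \<in> E. fst e < p \<and> p < snd e \<and> snd e < q \<or> p < fst e \<and> fst e < q \<and> q < snd e}"
    define S where "S = {g p, g q} \<union> (\<lambda>e. g (fst e)) ` ?S"
    have "finite ?S" using finE by simp
    from order_trans[OF card_image_le[OF this] thin[OF generic w pq(1)]]
    have "card ((\<lambda>e. g (fst e)) ` ?S) \<le> 4 * t - 10" .
    moreover have "card {g p, g q} \<le> 2" by (simp add: card_insert_if)
    ultimately have card: "card S \<le> k"
      unfolding S_def k_def using card_Un_le[of "{g p, g q}" "(\<lambda>e. g (fst e)) ` ?S"] assms(1) by linarith
    have gV: "g x \<in> verts G" if "x \<in> V" for x
      using that g unfolding V_def by auto
    have "cut_cover G (I p q) S"
      unfolding cut_cover_def
    proof (intro conjI allI impI)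
      show "S \<subseteq> verts G" unfolding S_def using gV pq chord by auto
      fix u v assume uv: "{u, v} \<in> edges G" "u \<in> I p q" "v \<notin> I p q"
      have V: "u \<in> verts G" "v \<in> verts G" using edgeV[OF uv(1)] by auto
      show "u \<in> S \<or> v \<in> S"
      proof (cases "\<beta> u = p \<or> \<beta> v = q")
        case True
        then show ?thesis unfolding S_def using g V by auto
      next
        case False
        then have lt: "p < \<beta> u" "\<beta> u < q" "\<beta> v < p \<or> q < \<beta> v" using uv V unfolding I_def by auto
        show ?thesis
        proof (cases "\<beta> v < p")
          case True
          have "{v, u} \<in> edges G" using uv(1) by (simp add: insert_commute)
          then have "(\<beta> v, \<beta> u) \<in> E" using True lt EI by simp
          then have "(\<beta> v, \<beta> u) \<in> ?S" using True lt by simp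
          then have "v \<in> S" unfolding S_def using g V by force
          then show ?thesis by simp
        next
          case False
          then have "(\<beta> u, \<beta> v) \<in> E" using lt uv(1) EI by simp
          then have "(\<beta> u, \<beta> v) \<in> ?S" using False lt by simp
          then have "u \<in> S" unfolding S_def using g V by force
          then show ?thesis by simp
        qed
      qed
    qed
    then show ?thesis using card by blast
  qed
  have lam: "thin_laminar G k (I p q)" if "triangulated V witnessed p q" for p q
    using that
  proof (induction rule: triangulated.induct)
    case (edge p q)
    then obtain v where v: "v \<in> verts G" "p = \<beta> v" unfolding V_def by auto
    have "I p q = {v}"
    proof
      show "I p q \<subseteq> {v}"
      proof
        fix u assume "u \<in> I p q"
        then have "\<beta> u = p" "u \<in> verts G" using edge(4)[of "\<beta> u"] unfolding I_def V_def by auto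
        then show "u \<in> {v}" using v inj unfolding inj_on_def by auto
      qed
    qed (use v edge(3) in \<open>auto simp: I_def\<close>)
    then show ?case using thin_laminar.single[OF v(1)] by simp
  next
    case (split p r q)
    have o: "p < r" "r < q" "p \<in> V" "q \<in> V"
      using triangulated_ends[OF split(1)] triangulated_ends[OF split(2)] by auto
    then have "I p q = I p r \<union> I r q" "I p r \<inter> I r q = {}" unfolding I_def by auto
    moreover obtain S where "cut_cover G (I p q) S" "card S \<le> k" using cover[OF split(3)] o by force
    ultimately show ?case using thin_laminar.union[OF split.IH] by simp
  qed
  have "thin_laminar G k (verts G)"
  proof -
    have mV: "Min V \<in> V" "Max V \<in> V" using Min_in[OF finV neV] Max_in[OF finV neV] by auto
    then obtain z where z: "z \<in> verts G" "\<beta> z = Max V" unfolding V_def by (metis imageE)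
    have le: "Min V \<le> \<beta> v \<and> \<beta> v \<le> Max V" if "v \<in> verts G" for v
      using Min_le[OF finV] Max_ge[OF finV] that unfolding V_def by blast
    have only: "v = z" if "v \<in> verts G" "\<beta> v = Max V" for v using that z inj unfolding inj_on_def by auto
    show ?thesis
    proof (cases "Min V < Max V")
      case True
      from witnessed_triangulated[OF mV True witnessed_Min_Max] have "thin_laminar G k (I (Min V) (Max V))"
        by (rule lam)
      \<comment> \<open>The half-open arc misses just the last vertex, which is added as a leaf; the
        cut of the whole vertex set is empty.\<close>
      moreover have "verts G = I (Min V) (Max V) \<union> {z}"
      proof -
        have "v \<in> I (Min V) (Max V) \<union> {z}" if "v \<in> verts G" for v
          using le[OF that] only[OF that] that unfolding I_def by (cases "\<beta> v = Max V") auto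
        then show ?thesis using z(1) unfolding I_def by blast
      qed
      moreover have "I (Min V) (Max V) \<inter> {z} = {}" using z(2) unfolding I_def by simp
      moreover have "cut_cover G (verts G) {}" using edgeV unfolding cut_cover_def by auto
      ultimately show ?thesis
        using thin_laminar.union[of G k "I (Min V) (Max V)" "{z}" "{}"] thin_laminar.single[OF z(1)]
        by (metis card.empty zero_le)
    next
      case False
      have "verts G = {z}"
      proof -
        have "v = z" if "v \<in> verts G" for v using le[OF that] False only[OF that] by auto
        then show ?thesis using z(1) by blast
      qed
      then show ?thesis using thin_laminar.single[OF z(1), of k] by metis
    qed
  qed
  from treewidth_thin_laminar[OF assms(2) k this] show ?thesis
    using assms(1) unfolding k_def by (simp add: of_nat_diff)
qed

end
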